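(* Let $T$ be the planted binary tree and let $t\in[0,1]$. For the $N$-parameter frozen percolation process on $T$, where the size of a cluster is measured by its volume, with law $\mathbb{P}_N$, and for Aldous' ($\infty$-parameter) frozen percolation process on $T$, with law $\mathbb{P}_\infty$, let $\mathcal{C}_t$ denote the open cluster of the root vertex at time $t$. Then $$\mathbb{P}_{N}\left(\mathcal{C}_{t}=C\right)\rightarrow\mathbb{P}_{\infty}\left(\mathcal{C}_{t}=C\right)\quad\text{as }N\rightarrow\infty$$ for all finite clusters $C$. Moreover $$\lim_{k\rightarrow\infty}\limsup_{N\rightarrow\infty}\mathbb{P}_{N}\left(k\leq\left|\mathcal{C}_{t}\right|<N\right)=0,$$ and hence the probability that the open cluster of the root vertex is frozen also converges: $$\mathbb{P}_{N}\left(N\leq\left|\mathcal{C}_{t}\right|\right)\rightarrow\mathbb{P}_{\infty}\left(\left|\mathcal{C}_{t}\right|=\infty\right)\quad\text{as }N\rightarrow\infty.$$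
   Context: The planted binary tree $T=(V,E)$ is the infinite tree in which one vertex $v_0$, the root vertex, has degree one and all other vertices have degree three. A cluster is a connected subgraph of $T$ (a single vertex, with no edges, is allowed); its volume $|C|$ is its number of edges. Let $(\tau_e)_{e\in E}$ be independent random variables, uniform on $[0,1]$. $N$-parameter frozen percolation process ($N$ a positive integer, size measured by volume): at time $0$ all edges are closed. At time $t$, an edge $e=(u,v)$ becomes open if $\tau_e=t$ and the open clusters of $u$ and $v$ at that time (just before $e$ opens) both have volume strictly smaller than $N$; otherwise $e$ stays closed (forever). Open edges stay open. This process exists (it is a finite-range interacting particle system); its law is $\mathbb{P}_N$. The open cluster $\mathcal{C}_t$ of the root vertex at time $t$ is the connected component of $v_0$ in the graph formed by the open edges at time $t$; it is called frozen when its volume is at least $N$. $\infty$-parameter (Aldous') frozen percolation process: at time $0$ all edges are closed, and each edge $e=(u,v)$ becomes open at time $\tau_e$ if the open clusters of $u$ and $v$ at that time are both finite, and otherwise stays closed. Aldous (2000) constructed this process on $T$; $\mathbb{P}_\infty$ is its law. Its one-time marginals for the root cluster (known from Aldous) are as follows: with $$\beta_\infty(t)=\mathbb{P}_\infty(\text{the root edge is closed at time }t)=\begin{cases}1-t & \text{if } t\in[0,1/2],\\ \frac1{4t} & \text{if } t\in[1/2,1],\end{cases}$$ one has $\mathbb{P}_\infty(\mathcal{C}_t=C)=\beta_\infty(t)\,(t\beta_\infty(t))^{|C|}$ for every finite cluster $C$ containing the root vertex $v_0$, and $\mathbb{P}_\infty(|\mathcal{C}_t|=\infty)=1-\sum_{C}\mathbb{P}_\infty(\mathcal{C}_t=C)$,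 the sum being over all finite clusters $C$ containing $v_0$. *)

theory Defs
  imports "HOL-Probability.Probability" "HOL-Library.Extended_Nat"
begin

text \<open>
  The planted binary tree. \<open>Node []\<close> is the only neighbour of the root vertex, and the children of
  \<open>Node bs\<close> are \<open>Node (b # bs)\<close> for \<open>b :: bool\<close>. Every vertex other than the root determines the
  edge to its parent, so the edges are indexed by \<^typ>\<open>bool list\<close>.
\<close>

datatype vertex = Root | Node "bool list"

type_synonym edge = "bool list"

fun parent :: "edge \<Rightarrow> vertex" where
  "parent [] = Root"
| "parent (b # bs) = Node bs"

definition ends :: "edge \<Rightarrow> vertex set" where
  "ends e = {parent e, Node e}"

lemma incident_Root: "{e. Root \<in> ends e} = {[]}"
proof -
  have "Root \<in> ends e \<longleftrightarrow> e = []" for e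
    by (cases e) (auto simp: ends_def)
  then show ?thesis by auto
qed

lemma incident_Node: "{e. Node bs \<in> ends e} = {bs, True # bs, False # bs}"
proof -
  have "Node bs \<in> ends e \<longleftrightarrow> e = bs \<or> e = True # bs \<or> e = False # bs" for e
    by (cases e) (auto simp: ends_def)
  then show ?thesis by auto
qed

lemma degree_Root: "card {e. Root \<in> ends e} = 1"
  by (simp add: incident_Root)

lemma degree_Node: "card {e. Node bs \<in> ends e} = 3"
proof -
  have "bs \<noteq> b # bs" for b
    by (metis not_Cons_self)
  then show ?thesis by (simp add: incident_Node)
qed

text \<open>A subgraph is a pair of a vertex set and an edge set.\<close>

type_synonym subgraph = "vertex set \<times> edge set"

definition adjacent :: "edge set \<Rightarrow> (vertex \<times> vertex) set" where
  "adjacent A = {(x, y). \<exists>e\<in>A. ends e = {x, y}}"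

definition cluster :: "subgraph \<Rightarrow> bool" where
  "cluster C \<longleftrightarrow> fst C \<noteq> {} \<and> (\<forall>e\<in>snd C. ends e \<subseteq> fst C) \<and>
     (\<forall>x\<in>fst C. \<forall>y\<in>fst C. (x, y) \<in> (adjacent (snd C))\<^sup>*)"

definition finite_cluster :: "subgraph \<Rightarrow> bool" where
  "finite_cluster C \<longleftrightarrow> cluster C \<and> finite (fst C) \<and> finite (snd C)"

definition cluster_volume :: "subgraph \<Rightarrow> enat" where
  "cluster_volume C = (if finite (snd C) then enat (card (snd C)) else \<infinity>)"

text \<open>The connected component of \<open>v\<close> in the graph whose edges are those in \<open>A\<close>.\<close>

definition open_cluster :: "edge set \<Rightarrow> vertex \<Rightarrow> subgraph" where
  "open_cluster A v =
     (let W = {w. (v, w) \<in> (adjacent A)\<^sup>*} in (W, {e \<in> A. ends e \<subseteq> W}))"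

text \<open>
  A path \<open>A\<close> of a process assigns to each time the set of edges that are open at that time. The
  state just before time \<open>u\<close> is its left limit at \<open>u\<close> (paths are increasing).
\<close>

definition open_before :: "(real \<Rightarrow> edge set) \<Rightarrow> real \<Rightarrow> edge set" where
  "open_before A u = (\<Union>s\<in>{0..<u}. A s)"

locale edge_clocks = prob_space M
  for M :: "'a measure" +
  fixes \<tau> :: "edge \<Rightarrow> 'a \<Rightarrow> real"
  assumes indep_clocks: "indep_vars (\<lambda>_. borel) \<tau> UNIV"
    and uniform_clocks: "distr M borel (\<tau> e) = uniform_measure lborel {0..1}"

text \<open>
  \<open>A \<omega> t\<close> is the set of edges open at time \<open>t\<close>. An edge can only open at the time given by its
  clock, and does so if and only if the clusters of both of its endpoints just before that time
  satisfy \<open>small\<close>. The process need not be a function of the clocks.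
\<close>

locale frozen_dynamics = edge_clocks M \<tau>
  for M :: "'a measure" and \<tau> :: "edge \<Rightarrow> 'a \<Rightarrow> real" +
  fixes small :: "subgraph \<Rightarrow> bool"
    and A :: "'a \<Rightarrow> real \<Rightarrow> edge set"
  assumes measurable_open: "t \<in> {0..1} \<Longrightarrow> {\<omega> \<in> space M. e \<in> A \<omega> t} \<in> sets M"
    and initially_closed: "AE \<omega> in M. A \<omega> 0 = {}"
    and dynamics: "AE \<omega> in M. \<forall>t\<in>{0..1}. A \<omega> t =
      {e. \<tau> e \<omega> \<le> t \<and>
          (\<forall>v\<in>ends e. small (open_cluster (open_before (A \<omega>) (\<tau> e \<omega>)) v))}"

locale frozen_percolation =
  frozen_dynamics M \<tau> "\<lambda>C. cluster_volume C < enat N" A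
  for N :: nat and M :: "'a measure" and \<tau> :: "edge \<Rightarrow> 'a \<Rightarrow> real"
    and A :: "'a \<Rightarrow> real \<Rightarrow> edge set" +
  assumes N_pos: "0 < N"

definition aldous_beta :: "real \<Rightarrow> real" where
  "aldous_beta t = (if t \<le> 1/2 then 1 - t else 1 / (4 * t))"

text \<open>
  The dynamics with infinite freezing threshold are not claimed to determine the law on their own.
  Aldous' process is therefore described by the dynamics together with the law of the root cluster
  at each fixed time that comes with Aldous' construction.
\<close>

locale aldous_percolation =
  frozen_dynamics M \<tau> "\<lambda>C. cluster_volume C < \<infinity>" A
  for M :: "'a measure" and \<tau> :: "edge \<Rightarrow> 'a \<Rightarrow> real" and A :: "'a \<Rightarrow> real \<Rightarrow> edge set" +
  assumes root_cluster_law: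
    "\<lbrakk>t \<in> {0..1}; finite_cluster C; Root \<in> fst C\<rbrakk> \<Longrightarrow>
      prob {\<omega> \<in> space M. open_cluster (A \<omega> t) Root = C} =
        aldous_beta t * (t * aldous_beta t) ^ card (snd C)"

end

theory Submission
  imports Defs
begin

text \<open>
  Whether an edge opens depends only on edges within distance \<open>N\<close> whose clocks ring earlier. Almost
  surely there is no infinite chain of such dependences, so the process is a function of the clocks.
  Cutting the tree below the root edge leaves two independent copies of it, and these do not
  influence each other while the clusters involved are small. Hence
  \<open>P\<^sub>N(C\<^sub>t = C) = \<beta> (t \<beta>)\<^bsup>|C|\<^esup>\<close> for \<open>|C| < N\<close>, where \<open>\<beta> = \<beta>\<^sub>N(t)\<close> is the probability that the root edge is
  closed, and \<open>\<beta>' = - \<beta>\<^sup>2 F\<^sub>N(t \<beta>)\<close> for the partial sums \<open>F\<^sub>N(x) = \<Sum>n<N. c\<^sub>n\<^sub>+\<^sub>1 x\<^sup>n\<close> of a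
  power series, with \<open>c\<^sub>n\<close> the Catalan numbers. The limit \<open>\<beta>\<^sub>\<infinity>\<close> satisfies the equation with the
  full series \<open>F\<close>, and a one-sided comparison gives \<open>0 \<le> \<beta>\<^sub>N(t) - \<beta>\<^sub>\<infinity>(t) \<le> t (F(1/4) - F\<^sub>N(1/4))\<close>.
  The tails are controlled by \<open>x F\<^sub>N(x) \<le> 1\<close> for \<open>x = t \<beta>\<^sub>N(t)\<close>, which holds since \<open>x\<close> decreases
  wherever it fails.
\<close>

section \<open>Clusters\<close>

text \<open>Conditioning on the clock \<open>s\<close> of the root edge gives the differential
  equation: the edge opens exactly when the two branch clusters just before \<open>s\<close> have
  fewer than \<open>N\<close> edges in total. There are c_(n+1) pairs with \<open>n\<close> edges in
  all, each of probability \<beta>^2 (s \<beta>)^n, so the edge opens at rate \<beta>^2 F_N(s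
  \<beta>). The obstacle is that large clusters make the branches interact through
  \<open>Node []\<close>, so a product formula is available only on events where the cluster of
  \<open>Node []\<close> is small. There an edge of a branch gets the same verdict in the branch and
  in the whole tree: an endpoint connected to \<open>Node []\<close> is small in both, and any other
  endpoint has its whole cluster inside the branch. The comparison is one-sided because F_N is
  increasing and lies below F: if \<beta>_N were below its limit, it would decay no faster than the
  limit does. For the tails, c_0 + ... + c_N x^N = 1 + x F_N(x) \<le> 2, and 2 is the full Catalan
  series at 1/4. This controls the truncated series even for x > 1/4, outside the disc of
  convergence.\<close>

definition reach :: "edge set \<Rightarrow> vertex \<Rightarrow> vertex set" where
  "reach A v = {w. (v, w) \<in> (adjacent A)\<^sup>*}"

definition cluster_edges :: "edge set \<Rightarrow> vertex \<Rightarrow> edge set" where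
  "cluster_edges A v = {e \<in> A. ends e \<subseteq> reach A v}"

text \<open>\<open>card\<close> sends infinite sets to 0, so finiteness has to be demanded
  separately.\<close>

definition small :: "nat \<Rightarrow> edge set \<Rightarrow> vertex \<Rightarrow> bool" where
  "small N A v \<longleftrightarrow> finite (cluster_edges A v) \<and> card (cluster_edges A v) < N"

lemma open_cluster_eq: "open_cluster A v = (reach A v, cluster_edges A v)"
  by (simp add: open_cluster_def reach_def cluster_edges_def Let_def)

lemma volume_less_iff_small: "cluster_volume (open_cluster A v) < enat N \<longleftrightarrow> small N A v"
  by (simp add: open_cluster_eq cluster_volume_def small_def)

lemma parent_neq_Node [simp]: "parent e \<noteq> Node e" "Node e \<noteq> parent e"
  by (cases e; simp)+

lemma adjacent_iff:
  "(x, y) \<in> adjacent A \<longleftrightarrow> (\<exists>e\<in>A. x = parent e \<and> y = Node e \<or> x = Node e \<and> y = parent e)"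
  by (auto simp: adjacent_def ends_def doubleton_eq_iff)

lemma sym_adjacent: "sym (adjacent A)"
  by (auto simp: sym_def adjacent_iff)

lemma reach_refl [simp]: "v \<in> reach A v"
  by (simp add: reach_def)

lemma reach_step:
  assumes "w \<in> reach A v" "e \<in> A" "w \<in> ends e"
  shows "ends e \<subseteq> reach A v"
proof
  fix u assume "u \<in> ends e"
  then have "w = u \<or> (w, u) \<in> adjacent A"
    using assms by (auto simp: adjacent_iff ends_def)
  then show "u \<in> reach A v"
    using assms(1) by (auto simp: reach_def)
qed

lemma reach_least:
  assumes "v \<in> W" and step: "\<And>e. e \<in> A \<Longrightarrow> ends e \<inter> W \<noteq> {} \<Longrightarrow> ends e \<subseteq> W"
  shows "reach A v \<subseteq> W"
proof
  fix w assume "w \<in> reach A v"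
  then have "(v, w) \<in> (adjacent A)\<^sup>*" by (simp add: reach_def)
  then show "w \<in> W"
  proof induction
    case base show ?case by fact
  next
    case (step y z)
    then obtain e where "e \<in> A" "y \<in> ends e" "z \<in> ends e"
      by (auto simp: adjacent_iff ends_def)
    with step.IH assms(2)[of e] show ?case by blast
  qed
qed

lemma reach_eq: "w \<in> reach A v \<Longrightarrow> reach A w = reach A v"
  unfolding reach_def
  by (auto intro: rtrancl_trans dest: symD[OF sym_rtrancl[OF sym_adjacent]])

lemma reach_mono: "A \<subseteq> B \<Longrightarrow> reach A v \<subseteq> reach B v"
  by (rule reach_least, simp) (metis Int_emptyI reach_step subsetD)

lemma cluster_edges_mono: "A \<subseteq> B \<Longrightarrow> cluster_edges A v \<subseteq> cluster_edges B v"
  using reach_mono[of A B v] by (auto simp: cluster_edges_def)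

lemma small_antimono: "A \<subseteq> B \<Longrightarrow> small N B v \<Longrightarrow> small N A v"
  unfolding small_def using cluster_edges_mono[of A B v]
  by (meson card_mono finite_subset le_less_trans)

lemma cluster_edges_eq: "w \<in> reach A v \<Longrightarrow> cluster_edges A w = cluster_edges A v"
  by (simp add: cluster_edges_def reach_eq)

lemma small_eq: "w \<in> reach A v \<Longrightarrow> small N A w = small N A v"
  by (simp add: small_def cluster_edges_eq)

text \<open>Agreement is demanded on the boundary edges too, so no edge of \<open>A'\<close> leaves
  the component. The inclusion obtained first lets the hypothesis be applied to edges touching
  \<open>reach A' v\<close>.\<close>

lemma reach_cong:
  assumes eq: "\<And>e. ends e \<inter> reach A v \<noteq> {} \<Longrightarrow> e \<in> A \<longleftrightarrow> e \<in> A'"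
  shows "reach A' v = reach A v"
proof
  show le: "reach A' v \<subseteq> reach A v"
    by (rule reach_least, simp) (metis Int_emptyI eq reach_step)
  show "reach A v \<subseteq> reach A' v"
  proof (rule reach_least)
    fix e assume "e \<in> A" "ends e \<inter> reach A' v \<noteq> {}"
    then show "ends e \<subseteq> reach A' v"
      using eq[of e] le reach_step[of _ A' v e] by blast
  qed simp
qed

lemma ends_nonempty [simp]: "ends e \<noteq> {}"
  by (simp add: ends_def)

lemma cluster_edges_cong:
  assumes "\<And>e. ends e \<inter> reach A v \<noteq> {} \<Longrightarrow> e \<in> A \<longleftrightarrow> e \<in> A'"
  shows "cluster_edges A' v = cluster_edges A v"
proof -
  have "e \<in> A' \<longleftrightarrow> e \<in> A" if "ends e \<subseteq> reach A v" for e
    using assms[of e] ends_nonempty[of e] that by blast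
  then show ?thesis
    by (auto simp: cluster_edges_def reach_cong[OF assms])
qed

section \<open>Locality\<close>

fun ball_in :: "edge set \<Rightarrow> nat \<Rightarrow> vertex \<Rightarrow> vertex set" where
  "ball_in A 0 v = {v}"
| "ball_in A (Suc n) v = ball_in A n v \<union> \<Union>{ends e |e. e \<in> A \<and> ends e \<inter> ball_in A n v \<noteq> {}}"

lemma ball_in_mono: "A \<subseteq> B \<Longrightarrow> ball_in A n v \<subseteq> ball_in B n v"
  by (induction n) (simp, fastforce)

lemma center_in_ball: "v \<in> ball_in A n v"
  by (induction n) auto

lemma ball_in_reach: "ball_in A n v \<subseteq> reach A v"
  by (induction n) (auto dest: reach_step)

text \<open>As long as the ball is not closed under adjacency, each increase of the radius adds an edge.\<close>

lemma ball_in_growth: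
  "(\<forall>e\<in>A. ends e \<inter> ball_in A n v \<noteq> {} \<longrightarrow> ends e \<subseteq> ball_in A n v) \<or>
   (\<exists>S\<subseteq>A. finite S \<and> card S = n \<and> (\<forall>e\<in>S. ends e \<subseteq> ball_in A n v))"
proof (induction n)
  case 0 show ?case by (rule disjI2) (auto intro!: exI[of _ "{}"])
next
  case (Suc n)
  show ?case
  proof (cases "\<forall>e\<in>A. ends e \<inter> ball_in A n v \<noteq> {} \<longrightarrow> ends e \<subseteq> ball_in A n v")
    case True
    then have "ball_in A (Suc n) v = ball_in A n v" by auto
    with True show ?thesis by simp
  next
    case False
    then obtain e where e: "e \<in> A" "ends e \<inter> ball_in A n v \<noteq> {}" "\<not> ends e \<subseteq> ball_in A n v"
      by blast
    obtain S where S: "S \<subseteq> A" "finite S" "card S = n" "\<forall>e\<in>S. ends e \<subseteq> ball_in A n v"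
      using Suc False by blast
    have "e \<notin> S" using S e by blast
    moreover have "ends e \<subseteq> ball_in A (Suc n) v" using e by auto
    ultimately show ?thesis
      using S e(1) by (intro disjI2 exI[of _ "insert e S"]) auto
  qed
qed

text \<open>If the ball of radius \<open>N\<close> inside \<open>A\<close> were not closed under
  \<open>A\<close>, it would contain \<open>N\<close> edges of \<open>A\<close>, all belonging to a
  cluster that has fewer.\<close>

lemma reach_in_ball:
  assumes "small N A v" shows "reach A v \<subseteq> ball_in UNIV N v"
proof -
  have "\<not> (\<exists>S\<subseteq>A. finite S \<and> card S = N \<and> (\<forall>e\<in>S. ends e \<subseteq> ball_in A N v))"
  proof
    assume "\<exists>S\<subseteq>A. finite S \<and> card S = N \<and> (\<forall>e\<in>S. ends e \<subseteq> ball_in A N v)"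
    then obtain S where S: "S \<subseteq> A" "card S = N" "\<forall>e\<in>S. ends e \<subseteq> ball_in A N v" by blast
    then have "S \<subseteq> cluster_edges A v"
      using ball_in_reach[of A N v] by (auto simp: cluster_edges_def)
    with assms S(2) show False
      unfolding small_def by (metis card_mono not_le)
  qed
  then have "reach A v \<subseteq> ball_in A N v"
    using ball_in_growth[of A N v]
    by (intro reach_least center_in_ball) blast
  then show ?thesis using ball_in_mono[of A UNIV N v] by blast
qed

text \<open>Edges that merely touch a ball are included: a small cluster stays in the ball, but
  seeing where it ends requires the edges that leave it.\<close>

definition near :: "nat \<Rightarrow> edge \<Rightarrow> edge set" where
  "near N e = {g. \<exists>v\<in>ends e. ends g \<inter> ball_in UNIV N v \<noteq> {}}"

text \<open>A cluster that is small in one set lies in the ball, where the sets agree, so it is the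
  cluster in the other set as well.\<close>

lemma small_cong:
  assumes "v \<in> ends e" "\<And>g. g \<in> near N e \<Longrightarrow> g \<in> A \<longleftrightarrow> g \<in> A'"
  shows "small N A v \<longleftrightarrow> small N A' v"
proof -
  have "small N A' v" if "small N A v" "\<And>g. g \<in> near N e \<Longrightarrow> g \<in> A \<longleftrightarrow> g \<in> A'" for A A'
  proof -
    have "g \<in> A \<longleftrightarrow> g \<in> A'" if "ends g \<inter> reach A v \<noteq> {}" for g
      using that reach_in_ball[OF \<open>small N A v\<close>] assms(1) \<open>\<And>g. g \<in> near N e \<Longrightarrow> g \<in> A \<longleftrightarrow> g \<in> A'\<close>
      by (auto simp: near_def)
    then have "cluster_edges A' v = cluster_edges A v" by (intro cluster_edges_cong)
    with that(1) show ?thesis by (simp add: small_def)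
  qed
  with assms(2) show ?thesis by metis
qed

lemma incident_card: "finite {e. v \<in> ends e}" "card {e. v \<in> ends e} \<le> 3"
proof -
  show "card {e. v \<in> ends e} \<le> 3"
    by (cases v) (simp_all add: degree_Root degree_Node)
  show "finite {e. v \<in> ends e}"
    by (cases v) (simp_all add: incident_Root incident_Node)
qed

lemma ends_card: "finite (ends e)" "card (ends e) = 2"
  by (simp_all add: ends_def)

lemma incident_set_card:
  assumes "finite W"
  shows "finite {e. ends e \<inter> W \<noteq> {}}" "card {e. ends e \<inter> W \<noteq> {}} \<le> 3 * card W"
proof -
  have eq: "{e. ends e \<inter> W \<noteq> {}} = (\<Union>v\<in>W. {e. v \<in> ends e})" by auto
  show "finite {e. ends e \<inter> W \<noteq> {}}"
    unfolding eq using assms incident_card(1) by blast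
  have "card (\<Union>v\<in>W. {e. v \<in> ends e}) \<le> (\<Sum>v\<in>W. card {e. v \<in> ends e})"
    using assms by (rule card_UN_le)
  also have "\<dots> \<le> (\<Sum>v\<in>W. 3)" by (intro sum_mono incident_card(2))
  finally show "card {e. ends e \<inter> W \<noteq> {}} \<le> 3 * card W" unfolding eq by simp
qed

text \<open>A vertex meets at most 3 edges with 2 ends each, so one step multiplies the size by at
  most 1 + 6.\<close>

lemma ball_card: "finite (ball_in UNIV n v) \<and> card (ball_in UNIV n v) \<le> 7 ^ n"
proof (induction n)
  case 0 show ?case by simp
next
  case (Suc n)
  let ?B = "ball_in UNIV n v" and ?I = "{e. ends e \<inter> ball_in UNIV n v \<noteq> {}}"
  have eq: "ball_in UNIV (Suc n) v = ?B \<union> (\<Union>e\<in>?I. ends e)" by auto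
  have fin: "finite ?I" using Suc incident_set_card(1) by blast
  have "card (\<Union>e\<in>?I. ends e) \<le> (\<Sum>e\<in>?I. card (ends e))" using fin by (rule card_UN_le)
  also have "\<dots> \<le> 6 * card ?B" using incident_set_card(2)[of ?B] Suc by (simp add: ends_card)
  finally have "card (ball_in UNIV (Suc n) v) \<le> 7 * card ?B"
    unfolding eq using card_Un_le[of ?B "\<Union>e\<in>?I. ends e"] by linarith
  moreover have "finite (ball_in UNIV (Suc n) v)"
    unfolding eq using Suc fin ends_card(1) by blast
  ultimately show ?case using Suc by (metis le_trans mult_le_mono2 power_Suc)
qed

lemma near_card: "finite (near N e)" "card (near N e) \<le> 6 * 7 ^ N"
proof -
  let ?J = "\<lambda>v. {g. ends g \<inter> ball_in UNIV N v \<noteq> {}}"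
  have eq: "near N e = (\<Union>v\<in>ends e. ?J v)" by (auto simp: near_def)
  have J: "finite (?J v)" "card (?J v) \<le> 3 * 7 ^ N" for v
    using ball_card[of N v] incident_set_card[of "ball_in UNIV N v"]
    by (auto intro: order_trans)
  show "finite (near N e)" unfolding eq using J(1) ends_card(1) by blast
  have "card (near N e) \<le> (\<Sum>v\<in>ends e. card (?J v))" unfolding eq by (intro card_UN_le ends_card)
  also have "\<dots> \<le> (\<Sum>v\<in>ends e. 3 * 7 ^ N)" by (intro sum_mono J)
  finally show "card (near N e) \<le> 6 * 7 ^ N" by (simp add: ends_card)
qed

section \<open>The set of edges that eventually open\<close>

definition opens :: "nat \<Rightarrow> (edge \<Rightarrow> real) \<Rightarrow> edge set \<Rightarrow> edge \<Rightarrow> bool" where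
  "opens N \<tau> X e \<longleftrightarrow> (\<forall>v\<in>ends e. small N {g \<in> X. \<tau> g < \<tau> e} v)"

text \<open>
  A process is described by the set \<open>X\<close> of the edges that ever open: the set of edges open at time
  \<open>t\<close> is \<open>{e \<in> X. \<tau> e \<le> t}\<close>. The predicate \<open>P\<close> restricts the dynamics to an initial time interval.
\<close>

definition solves :: "nat \<Rightarrow> (edge \<Rightarrow> real) \<Rightarrow> (real \<Rightarrow> bool) \<Rightarrow> edge set \<Rightarrow> bool" where
  "solves N \<tau> P X \<longleftrightarrow> (\<forall>e. P (\<tau> e) \<longrightarrow> (e \<in> X \<longleftrightarrow> opens N \<tau> X e))"

text \<open>The relation along which the dynamics is a recursion: the decision at \<open>e\<close>
  reads only near edges with earlier clocks.\<close>

definition dependence :: "nat \<Rightarrow> (edge \<Rightarrow> real) \<Rightarrow> (edge \<times> edge) set" where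
  "dependence N \<tau> = {(g, e). \<tau> g < \<tau> e \<and> g \<in> near N e}"

lemma opens_cong:
  assumes "\<And>g. (g, e) \<in> dependence N \<tau> \<Longrightarrow> g \<in> X \<longleftrightarrow> g \<in> Y"
  shows "opens N \<tau> X e \<longleftrightarrow> opens N \<tau> Y e"
  unfolding opens_def
proof (intro ball_cong refl)
  fix v assume "v \<in> ends e"
  then show "small N {g \<in> X. \<tau> g < \<tau> e} v \<longleftrightarrow> small N {g \<in> Y. \<tau> g < \<tau> e} v"
    by (rule small_cong) (use assms in \<open>auto simp: dependence_def\<close>)
qed

text \<open>Induction along \<open>dependence\<close>: the rule at \<open>e\<close> reads only
  predecessors, and these satisfy \<open>P\<close> because \<open>P\<close> is closed
  downwards.\<close>

lemma solves_unique:
  assumes wf: "wf (dependence N \<tau>)" and down: "\<And>x y. x < y \<Longrightarrow> P y \<Longrightarrow> P x"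
    and X: "solves N \<tau> P X" and Y: "solves N \<tau> P Y"
  shows "P (\<tau> e) \<Longrightarrow> e \<in> X \<longleftrightarrow> e \<in> Y"
  using wf
proof (induction e rule: wf_induct_rule)
  case (less e)
  have "opens N \<tau> X e \<longleftrightarrow> opens N \<tau> Y e"
    by (rule opens_cong) (use less down in \<open>auto simp: dependence_def\<close>)
  with less.prems X Y show ?case by (simp add: solves_def)
qed

text \<open>Iterating the rule from the empty set makes sense for all clocks, including those for
  which \<open>dependence\<close> is not well-founded.\<close>

fun iterate :: "nat \<Rightarrow> (edge \<Rightarrow> real) \<Rightarrow> nat \<Rightarrow> edge set" where
  "iterate N \<tau> 0 = {}"
| "iterate N \<tau> (Suc n) = {e. opens N \<tau> (iterate N \<tau> n) e}"

text \<open>The limit inferior of the iterates is measurable in the clocks, whether or not they converge.\<close>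

definition sol :: "nat \<Rightarrow> (edge \<Rightarrow> real) \<Rightarrow> edge set" where
  "sol N \<tau> = {e. \<exists>m. \<forall>n\<ge>m. e \<in> iterate N \<tau> n}"

text \<open>An edge has finitely many predecessors; one iteration after the last of them has
  settled, it settles too.\<close>

lemma iterate_stable:
  assumes "wf (dependence N \<tau>)"
  shows "\<exists>m. \<forall>n\<ge>m. e \<in> iterate N \<tau> n \<longleftrightarrow> e \<in> iterate N \<tau> m"
  using assms
proof (induction e rule: wf_induct_rule)
  case (less e)
  let ?D = "{g. (g, e) \<in> dependence N \<tau>}"
  have fin: "finite ?D"
    by (rule finite_subset[OF _ near_card(1)[of N e]]) (auto simp: dependence_def)
  obtain m where m: "\<And>g n. g \<in> ?D \<Longrightarrow> n \<ge> m g \<Longrightarrow> g \<in> iterate N \<tau> n \<longleftrightarrow> g \<in> iterate N \<tau> (m g)"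
    using less by (metis mem_Collect_eq)
  define k where "k = Max (insert 0 (m ` ?D))"
  have k: "m g \<le> k" if "g \<in> ?D" for g
    unfolding k_def using fin that by auto
  have "e \<in> iterate N \<tau> (Suc n) \<longleftrightarrow> e \<in> iterate N \<tau> (Suc k)" if "n \<ge> k" for n
  proof -
    have "g \<in> iterate N \<tau> n \<longleftrightarrow> g \<in> iterate N \<tau> k" if "(g, e) \<in> dependence N \<tau>" for g
      using m[of g n] m[of g k] k[of g] that \<open>n \<ge> k\<close> by force
    then have "opens N \<tau> (iterate N \<tau> n) e \<longleftrightarrow> opens N \<tau> (iterate N \<tau> k) e"
      by (rule opens_cong)
    then show ?thesis by simp
  qed
  then show ?case
    by (intro exI[of _ "Suc k"]) (metis Suc_le_D Suc_le_mono)
qed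

lemma solves_sol:
  assumes wf: "wf (dependence N \<tau>)"
  shows "solves N \<tau> (\<lambda>_. True) (sol N \<tau>)"
  unfolding solves_def
proof (intro allI impI)
  fix e
  have ev: "\<exists>m. \<forall>n\<ge>m. g \<in> iterate N \<tau> n \<longleftrightarrow> g \<in> sol N \<tau>" for g
  proof -
    obtain m where m: "\<And>n. n \<ge> m \<Longrightarrow> g \<in> iterate N \<tau> n \<longleftrightarrow> g \<in> iterate N \<tau> m"
      using iterate_stable[OF wf, of g] by blast
    have "g \<in> sol N \<tau> \<longleftrightarrow> g \<in> iterate N \<tau> m"
    proof
      assume "g \<in> sol N \<tau>"
      then obtain m' where "\<And>n. n \<ge> m' \<Longrightarrow> g \<in> iterate N \<tau> n" by (auto simp: sol_def)
      then have "g \<in> iterate N \<tau> (max m m')" by simp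
      with m[of "max m m'"] show "g \<in> iterate N \<tau> m" by simp
    next
      assume "g \<in> iterate N \<tau> m"
      then have "g \<in> iterate N \<tau> n" if "n \<ge> m" for n using m[OF that] by (rule iffD2[rotated])
      then show "g \<in> sol N \<tau>" unfolding sol_def by blast
    qed
    then have "g \<in> iterate N \<tau> n \<longleftrightarrow> g \<in> sol N \<tau>" if "n \<ge> m" for n
      using m[OF that] by (rule trans[rotated, OF sym])
    then show ?thesis by blast
  qed
  then have "\<forall>g. \<exists>m. \<forall>n\<ge>m. g \<in> iterate N \<tau> n \<longleftrightarrow> g \<in> sol N \<tau>" by blast
  from choice[OF this]
  obtain m where m: "\<And>g n. n \<ge> m g \<Longrightarrow> g \<in> iterate N \<tau> n \<longleftrightarrow> g \<in> sol N \<tau>" by blast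
  let ?D = "{g. (g, e) \<in> dependence N \<tau>}"
  have fin: "finite ?D"
    by (rule finite_subset[OF _ near_card(1)[of N e]]) (auto simp: dependence_def)
  \<comment> \<open>From stage \<open>k\<close> on, \<open>e\<close> and all its predecessors have
    their final values, so one application of the rule at stage \<open>k\<close> is the equation for
    \<open>sol\<close>.\<close>
  define k where "k = Max (insert (m e) (m ` ?D))"
  have k: "m g \<le> k" if "g \<in> insert e ?D" for g
    unfolding k_def using fin that by auto
  have "e \<in> sol N \<tau> \<longleftrightarrow> e \<in> iterate N \<tau> (Suc k)"
    using m[of e "Suc k"] k[of e] by simp
  also have "\<dots> \<longleftrightarrow> opens N \<tau> (iterate N \<tau> k) e" by simp
  also have "\<dots> \<longleftrightarrow> opens N \<tau> (sol N \<tau>) e"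
    by (rule opens_cong) (use m k in blast)
  finally show "e \<in> sol N \<tau> \<longleftrightarrow> opens N \<tau> (sol N \<tau>) e" .
qed

section \<open>Splitting the tree below the root edge\<close>

text \<open>Lists grow at the head when moving away from the root, so the first turn below
  \<open>Node []\<close> is the last entry: branch \<open>b\<close> consists of the lists that end
  with \<open>b\<close>.\<close>

definition sub :: "bool \<Rightarrow> edge set \<Rightarrow> edge set" where
  "sub b X = {e. e @ [b] \<in> X}"

text \<open>Embeds the planted tree as a branch. \<open>Root\<close> goes to \<open>Node []\<close>
  for both values of \<open>b\<close>; this is the only vertex shared by the branches.\<close>

fun lift :: "bool \<Rightarrow> vertex \<Rightarrow> vertex" where
  "lift b Root = Node []"
| "lift b (Node bs) = Node (bs @ [b])"

lemma ends_append: "ends (e @ [b]) = lift b ` ends e"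
  by (cases e) (auto simp: ends_def)

lemma ends_Nil: "ends [] = {Root, Node []}"
  by (simp add: ends_def)

lemma lift_inject [simp]: "lift b v = lift b w \<longleftrightarrow> v = w"
  by (cases v; cases w; simp)

lemma lift_neq_Root [simp]: "lift b v \<noteq> Root" "Root \<noteq> lift b v"
  by (cases v; simp)+

lemma lift_eq_Node_Nil [simp]: "lift b v = Node [] \<longleftrightarrow> v = Root" "Node [] = lift b v \<longleftrightarrow> v = Root"
  by (cases v; simp)+

lemma lift_eq_lift: "b \<noteq> c \<Longrightarrow> lift b v = lift c w \<longleftrightarrow> v = Root \<and> w = Root"
  by (cases v; cases w; auto)

lemma edge_cases: obtains "e = []" | f b where "e = f @ [b]"
  by (cases e rule: rev_cases) auto

lemma lift_reach: "lift b ` reach (sub b X) v \<subseteq> reach X (lift b v)"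
proof -
  have "reach (sub b X) v \<subseteq> {w. lift b w \<in> reach X (lift b v)}"
  proof (rule reach_least)
    fix e assume "e \<in> sub b X" "ends e \<inter> {w. lift b w \<in> reach X (lift b v)} \<noteq> {}"
    then show "ends e \<subseteq> {w. lift b w \<in> reach X (lift b v)}"
      using reach_step[of _ X "lift b v" "e @ [b]"] by (auto simp: sub_def ends_append)
  qed simp
  then show ?thesis by auto
qed

text \<open>A component that avoids the root of the branch does not meet \<open>Node []\<close>, the
  only exit from the branch.\<close>

lemma reach_lift:
  assumes "Root \<notin> reach (sub b X) v"
  shows "reach X (lift b v) = lift b ` reach (sub b X) v"
proof
  show "reach X (lift b v) \<subseteq> lift b ` reach (sub b X) v"
  proof (rule reach_least)
    fix e assume e: "e \<in> X" "ends e \<inter> lift b ` reach (sub b X) v \<noteq> {}"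
    show "ends e \<subseteq> lift b ` reach (sub b X) v"
    proof (cases e rule: edge_cases)
      case 1 with e assms show ?thesis by (auto simp: ends_Nil)
    next
      case (2 f c)
      have "c = b"
      proof (rule ccontr)
        assume "c \<noteq> b"
        with e(2) assms 2 show False by (auto simp: ends_append lift_eq_lift)
      qed
      then obtain w where "w \<in> ends f" "w \<in> reach (sub b X) v"
        using 2 e by (auto simp: ends_append)
      then have "ends f \<subseteq> reach (sub b X) v"
        using 2 e \<open>c = b\<close> by (intro reach_step[of w]) (auto simp: sub_def)
      then show ?thesis
        unfolding 2 \<open>c = b\<close> ends_append by (rule image_mono)
    qed
  qed simp
qed (rule lift_reach)

lemma cluster_edges_lift:
  assumes "Root \<notin> reach (sub b X) v"
  shows "cluster_edges X (lift b v) = (\<lambda>e. e @ [b]) ` cluster_edges (sub b X) v"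
proof
  show "cluster_edges X (lift b v) \<subseteq> (\<lambda>e. e @ [b]) ` cluster_edges (sub b X) v"
  proof
    fix e assume "e \<in> cluster_edges X (lift b v)"
    then have e: "e \<in> X" "ends e \<subseteq> lift b ` reach (sub b X) v"
      by (auto simp: cluster_edges_def reach_lift[OF assms])
    show "e \<in> (\<lambda>e. e @ [b]) ` cluster_edges (sub b X) v"
    proof (cases e rule: edge_cases)
      case 1 with e assms show ?thesis by (auto simp: ends_Nil)
    next
      case (2 f c)
      have "Node f \<in> ends f" by (simp add: ends_def)
      then have "lift c (Node f) \<in> lift b ` reach (sub b X) v"
        using e 2 by (auto simp: ends_append)
      then have "c = b" using lift_eq_lift[of c b "Node f"] by (metis imageE vertex.distinct(1))
      then have "ends f \<subseteq> reach (sub b X) v"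
        using e(2) 2 by (auto simp: ends_append inj_image_subset_iff inj_on_def)
      then have "f \<in> cluster_edges (sub b X) v"
        using e(1) 2 \<open>c = b\<close> by (simp add: cluster_edges_def sub_def)
      then show ?thesis using 2 \<open>c = b\<close> by blast
    qed
  qed
  show "(\<lambda>e. e @ [b]) ` cluster_edges (sub b X) v \<subseteq> cluster_edges X (lift b v)"
  proof (intro image_subsetI)
    fix f assume f: "f \<in> cluster_edges (sub b X) v"
    then have "ends (f @ [b]) \<subseteq> lift b ` reach (sub b X) v"
      unfolding ends_append cluster_edges_def by (intro image_mono) auto
    also note lift_reach
    finally show "f @ [b] \<in> cluster_edges X (lift b v)"
      using f by (simp add: cluster_edges_def sub_def)
  qed
qed

lemma inj_append: "inj_on (\<lambda>e. e @ [b]) S"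
  by (simp add: inj_on_def)

text \<open>Puts two branch clusters under an open root edge; \<open>sub False\<close> and
  \<open>sub True\<close> recover them.\<close>

definition join :: "edge set \<Rightarrow> edge set \<Rightarrow> edge set" where
  "join l r = insert [] ((\<lambda>e. e @ [False]) ` l \<union> (\<lambda>e. e @ [True]) ` r)"

lemma Nil_in_join [simp]: "[] \<in> join l r"
  by (simp add: join_def)

lemma append_in_join [simp]: "e @ [b] \<in> join l r \<longleftrightarrow> e \<in> (if b then r else l)"
  by (cases b) (simp_all add: join_def image_iff)

lemma sub_join [simp]: "sub b (join l r) = (if b then r else l)"
  by (simp add: sub_def)

lemma join_inject [simp]: "join l r = join l' r' \<longleftrightarrow> l = l' \<and> r = r'"
  by (metis sub_join)

lemma finite_join [simp]: "finite (join l r) \<longleftrightarrow> finite l \<and> finite r"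
  by (simp add: join_def finite_image_iff inj_append)

lemma card_join: "finite l \<Longrightarrow> finite r \<Longrightarrow> card (join l r) = Suc (card l + card r)"
  unfolding join_def
  by (subst card_insert_disjoint; (subst card_Un_disjoint)?) (auto simp: card_image inj_append)

abbreviation "root_cluster X \<equiv> cluster_edges X Root"

lemma reach_Node_Nil:
  "reach X (Node []) = (\<Union>b. lift b ` reach (sub b X) Root) \<union> (if [] \<in> X then {Root} else {})"
  (is "_ = ?W")
proof
  show "reach X (Node []) \<subseteq> ?W"
  proof (rule reach_least)
    show "Node [] \<in> ?W" by (auto intro!: image_eqI[of _ _ Root])
    fix e assume e: "e \<in> X" "ends e \<inter> ?W \<noteq> {}"
    have nn: "Node [] \<in> (\<Union>b. lift b ` reach (sub b X) Root)"
      by (auto intro!: image_eqI[of _ _ Root])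
    show "ends e \<subseteq> ?W"
    proof (cases e rule: edge_cases)
      case 1 with e nn show ?thesis by (auto simp: ends_Nil)
    next
      case (2 f b)
      obtain w where w: "w \<in> ends f" "lift b w \<in> ?W" using e(2) 2 by (auto simp: ends_append)
      then obtain c u where u: "u \<in> reach (sub c X) Root" "lift b w = lift c u"
        by (auto split: if_splits)
      then have "w \<in> reach (sub b X) Root"
        using lift_eq_lift[of b c w u] by (cases "b = c") auto
      then have "ends f \<subseteq> reach (sub b X) Root"
        using reach_step[of w "sub b X" Root f] w(1) e(1) 2 by (auto simp: sub_def)
      then show ?thesis using 2 by (auto simp: ends_append)
    qed
  qed
  have "Root \<in> reach X (Node [])" if "[] \<in> X"
    using reach_step[of "Node []" X "Node []" "[]"] that by (simp add: ends_Nil)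
  then show "?W \<subseteq> reach X (Node [])"
    using lift_reach[of _ X Root] by auto
qed

lemma cluster_edges_Node_Nil:
  "cluster_edges X (Node []) =
     (if [] \<in> X then {[]} else {}) \<union> (\<Union>b. (\<lambda>e. e @ [b]) ` root_cluster (sub b X))"
  (is "_ = ?E")
proof -
  have "e \<in> cluster_edges X (Node []) \<longleftrightarrow> e \<in> ?E" for e
  proof (cases e rule: edge_cases)
    case 1
    then show ?thesis
      by (auto simp: cluster_edges_def ends_Nil reach_Node_Nil intro!: image_eqI[of _ _ Root])
  next
    case (2 f b)
    have "lift b w \<in> reach X (Node []) \<longleftrightarrow> w \<in> reach (sub b X) Root" for w
    proof -
      have "w \<in> reach (sub b X) Root" if "u \<in> reach (sub c X) Root" "lift b w = lift c u" for c u
        using that lift_eq_lift[of b c w u] by (cases "b = c") auto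
      then show ?thesis by (auto simp: reach_Node_Nil)
    qed
    then have "e \<in> cluster_edges X (Node []) \<longleftrightarrow> f \<in> root_cluster (sub b X)"
      using 2 by (auto simp: cluster_edges_def ends_append sub_def)
    also have "\<dots> \<longleftrightarrow> e \<in> ?E" using 2 by auto
    finally show ?thesis .
  qed
  then show ?thesis by blast
qed

lemma root_cluster_closed: "[] \<notin> X \<Longrightarrow> root_cluster X = {}"
proof -
  assume "[] \<notin> X"
  then have "reach X Root \<subseteq> {Root}"
    by (intro reach_least) (auto simp: ends_def split: if_splits, (metis parent.elims vertex.distinct(1))+)
  then show ?thesis by (auto simp: cluster_edges_def ends_def)
qed

lemma root_cluster_join:
  assumes "[] \<in> X"
  shows "root_cluster X = join (root_cluster (sub False X)) (root_cluster (sub True X))"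
proof -
  have "Node [] \<in> reach X Root"
    using reach_step[of Root X Root "[]"] assms by (simp add: ends_Nil)
  then have "root_cluster X = cluster_edges X (Node [])" by (rule cluster_edges_eq[symmetric])
  then show ?thesis using assms by (auto simp: cluster_edges_Node_Nil join_def UNIV_bool)
qed

lemma root_cluster_empty_iff: "root_cluster X = {} \<longleftrightarrow> [] \<notin> X"
  using root_cluster_closed[of X] root_cluster_join[of X] Nil_in_join by (metis empty_iff)

lemma small_Node_Nil:
  "small N X (Node []) \<longleftrightarrow> finite (root_cluster (sub False X)) \<and> finite (root_cluster (sub True X)) \<and>
     card (root_cluster (sub False X)) + card (root_cluster (sub True X)) + (if [] \<in> X then 1 else 0) < N"
proof -
  let ?l = "root_cluster (sub False X)" and ?r = "root_cluster (sub True X)"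
  \<comment> \<open>\<open>join\<close> always contains the root edge, which has to be taken out
    again if it is closed.\<close>
  have eq: "cluster_edges X (Node []) = (if [] \<in> X then join ?l ?r else join ?l ?r - {[]})"
    by (auto simp: cluster_edges_Node_Nil join_def UNIV_bool)
  show ?thesis
    by (cases "finite ?l \<and> finite ?r") (auto simp: small_def eq card_join)
qed

text \<open>A vertex connected to \<open>Node []\<close> within the branch is small in both graphs,
  because the branch cluster is part of the small cluster of \<open>Node []\<close>. Any other
  vertex has a cluster that never leaves the branch.\<close>

lemma small_lift:
  assumes "small N Y (Node [])"
  shows "small N Y (lift b v) \<longleftrightarrow> small N (sub b Y) v"
proof (cases "Root \<in> reach (sub b Y) v")
  case True
  then have "Node [] \<in> reach Y (lift b v)"
    using lift_reach[of b Y v] by force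
  then have "small N Y (lift b v)" using small_eq assms by blast
  moreover have "small N (sub b Y) Root"
    using assms[unfolded small_Node_Nil] by (cases b) (auto simp: small_def)
  ultimately show ?thesis using small_eq[OF True] by blast
next
  case False
  then show ?thesis
    by (simp add: small_def cluster_edges_lift finite_image_iff inj_append card_image)
qed

section \<open>Solutions on the branches and on the whole tree\<close>

definition branch :: "bool \<Rightarrow> (edge \<Rightarrow> real) \<Rightarrow> edge \<Rightarrow> real" where
  "branch b \<tau> e = \<tau> (e @ [b])"

text \<open>\<open>P\<close> will be \<open>x \<le> t\<close> or \<open>x < t\<close>, which treats
  the state at time \<open>t\<close> and the state just before it together.\<close>

definition sol_at :: "nat \<Rightarrow> (real \<Rightarrow> bool) \<Rightarrow> (edge \<Rightarrow> real) \<Rightarrow> edge set" where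
  "sol_at N P \<tau> = {e \<in> sol N \<tau>. P (\<tau> e)}"

text \<open>Well-foundedness on the branches makes \<open>sol\<close> a solution there too, so that
  it can be compared with restrictions of the global solution by uniqueness.\<close>

definition regular :: "nat \<Rightarrow> (edge \<Rightarrow> real) \<Rightarrow> bool" where
  "regular N \<tau> \<longleftrightarrow> wf (dependence N \<tau>) \<and> (\<forall>b. wf (dependence N (branch b \<tau>)))"

lemma opens_append:
  "opens N \<tau> X (e @ [b]) \<longleftrightarrow> (\<forall>v\<in>ends e. small N {g \<in> X. \<tau> g < \<tau> (e @ [b])} (lift b v))"
  by (simp add: opens_def ends_append)

lemma sub_filter: "sub b {g \<in> X. Q (\<tau> g)} = {g \<in> sub b X. Q (branch b \<tau> g)}"
  by (auto simp: sub_def branch_def)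

text \<open>The edges open before this clock rings form a subset of those cut out by
  \<open>P\<close>, so \<open>Node []\<close> is still small at that moment and
  \<open>small_lift\<close> applies.\<close>

lemma opens_append_small:
  assumes "small N {g \<in> X. P (\<tau> g)} (Node [])" and down: "\<And>x y. x < y \<Longrightarrow> P y \<Longrightarrow> P x"
    and "P (\<tau> (e @ [b]))"
  shows "opens N \<tau> X (e @ [b]) \<longleftrightarrow> opens N (branch b \<tau>) (sub b X) e"
proof -
  let ?Y = "{g \<in> X. \<tau> g < \<tau> (e @ [b])}"
  have "?Y \<subseteq> {g \<in> X. P (\<tau> g)}" using assms(3) down by auto
  then have "small N ?Y (Node [])" using assms(1) small_antimono by blast
  then have "opens N \<tau> X (e @ [b]) \<longleftrightarrow> (\<forall>v\<in>ends e. small N (sub b ?Y) v)"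
    by (simp add: opens_append small_lift)
  then show ?thesis
    by (simp add: opens_def sub_filter[of b X "\<lambda>x. x < \<tau> (e @ [b])"]) (simp add: branch_def)
qed

text \<open>While \<open>Node []\<close> is small, the restriction of the global solution obeys the
  dynamics of the branch; uniqueness identifies it with the solution of the branch.\<close>

lemma branch_unaffected:
  assumes reg: "regular N \<tau>" and down: "\<And>x y. x < y \<Longrightarrow> P y \<Longrightarrow> P x"
    and small: "small N (sol_at N P \<tau>) (Node [])"
  shows "sub b (sol_at N P \<tau>) = sol_at N P (branch b \<tau>)"
proof -
  have wf: "wf (dependence N \<tau>)" "wf (dependence N (branch b \<tau>))"
    using reg by (auto simp: regular_def)
  have s1: "solves N (branch b \<tau>) P (sub b (sol N \<tau>))"
    unfolding solves_def
  proof (intro allI impI)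
    fix e assume "P (branch b \<tau> e)"
    then have "opens N \<tau> (sol N \<tau>) (e @ [b]) \<longleftrightarrow> opens N (branch b \<tau>) (sub b (sol N \<tau>)) e"
      using small down by (intro opens_append_small[of N "sol N \<tau>" P]) (auto simp: sol_at_def branch_def)
    then show "e \<in> sub b (sol N \<tau>) \<longleftrightarrow> opens N (branch b \<tau>) (sub b (sol N \<tau>)) e"
      using solves_sol[OF wf(1)] by (simp add: solves_def sub_def)
  qed
  have s2: "solves N (branch b \<tau>) P (sol N (branch b \<tau>))"
    using solves_sol[OF wf(2)] by (simp add: solves_def)
  have "e \<in> sub b (sol N \<tau>) \<longleftrightarrow> e \<in> sol N (branch b \<tau>)" if "P (branch b \<tau> e)" for e
    using that by (rule solves_unique[OF wf(2) _ s1 s2, rotated]) (rule down)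
  then show ?thesis
    unfolding sol_at_def sub_filter by blast
qed

text \<open>The converse passage, where smallness is known only for the two separate branch
  processes. Pasting their solutions under the root edge gives a set obeying the global rule, so by
  uniqueness it is the global solution.\<close>

lemma branches_determine:
  assumes reg: "regular N \<tau>" and down: "\<And>x y. x < y \<Longrightarrow> P y \<Longrightarrow> P x"
    and fin: "\<And>b. finite (root_cluster (sol_at N P (branch b \<tau>)))"
    and less: "card (root_cluster (sol_at N P (branch False \<tau>))) +
      card (root_cluster (sol_at N P (branch True \<tau>))) + (if P (\<tau> []) then 1 else 0) < N"
  shows "sub b (sol_at N P \<tau>) = sol_at N P (branch b \<tau>)"
    and "[] \<in> sol_at N P \<tau> \<longleftrightarrow> P (\<tau> [])"
proof -
  have wf: "wf (dependence N \<tau>)" "\<And>b. wf (dependence N (branch b \<tau>))"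
    using reg by (auto simp: regular_def)
  let ?X = "join (sol N (branch False \<tau>)) (sol N (branch True \<tau>))"
  let ?Y = "{g \<in> ?X. P (\<tau> g)}"
  have subX: "sub b ?X = sol N (branch b \<tau>)" for b by simp
  have subY: "sub b ?Y = sol_at N P (branch b \<tau>)" for b
    unfolding sub_filter subX by (simp add: sol_at_def)
  have small: "small N ?Y (Node [])"
    unfolding small_Node_Nil subY using fin less by simp
  have s1: "solves N \<tau> P ?X"
    unfolding solves_def
  proof (intro allI impI)
    fix e assume e: "P (\<tau> e)"
    show "e \<in> ?X \<longleftrightarrow> opens N \<tau> ?X e"
    proof (cases e rule: edge_cases)
      case 1
      let ?Z = "{g \<in> ?X. \<tau> g < \<tau> []}"
      have "?Z \<subseteq> ?Y" using e 1 down by auto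
      then have "small N ?Z (Node [])" using small small_antimono by blast
      \<comment> \<open>The root edge is not earlier than itself, so the cluster of
        \<open>Root\<close> in \<open>?Z\<close> is empty; \<open>less\<close> supplies
        \<open>0 < N\<close>.\<close>
      moreover have "small N ?Z Root"
        using less by (simp add: small_def root_cluster_closed)
      ultimately show ?thesis using 1 by (simp add: opens_def ends_Nil)
    next
      case (2 f b)
      have "opens N \<tau> ?X e \<longleftrightarrow> opens N (branch b \<tau>) (sub b ?X) f"
        unfolding 2 using small down e 2 by (intro opens_append_small[of N ?X P]) auto
      also have "\<dots> \<longleftrightarrow> f \<in> sub b ?X"
        unfolding subX using solves_sol[OF wf(2)] by (simp add: solves_def)
      finally show ?thesis using 2 by (simp add: sub_def)
    qed
  qed
  have s2: "solves N \<tau> P (sol N \<tau>)"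
    using solves_sol[OF wf(1)] by (simp add: solves_def)
  have "e \<in> ?X \<longleftrightarrow> e \<in> sol N \<tau>" if "P (\<tau> e)" for e
    using that by (rule solves_unique[OF wf(1) _ s1 s2, rotated]) (rule down)
  then have eq: "sol_at N P \<tau> = ?Y" unfolding sol_at_def by blast
  show "sub b (sol_at N P \<tau>) = sol_at N P (branch b \<tau>)" unfolding eq by (rule subY)
  show "[] \<in> sol_at N P \<tau> \<longleftrightarrow> P (\<tau> [])" unfolding eq by simp
qed

text \<open>This is where the cluster event becomes a product event. A root edge cannot be refused
  while the total stays below \<open>N\<close>, hence the bare condition
  \<open>P (\<tau> [])\<close> on its clock.\<close>

lemma root_cluster_eq_join_iff:
  assumes reg: "regular N \<tau>" and down: "\<And>x y. x < y \<Longrightarrow> P y \<Longrightarrow> P x"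
    and fin: "finite l" "finite r" and less: "card (join l r) < N"
  shows "root_cluster (sol_at N P \<tau>) = join l r \<longleftrightarrow> P (\<tau> []) \<and>
    root_cluster (sol_at N P (branch False \<tau>)) = l \<and> root_cluster (sol_at N P (branch True \<tau>)) = r"
    (is "?L \<longleftrightarrow> ?R")
proof
  assume L: ?L
  then have Nil: "[] \<in> sol_at N P \<tau>"
    using root_cluster_closed Nil_in_join by blast
  have *: "root_cluster (sub False (sol_at N P \<tau>)) = l" "root_cluster (sub True (sol_at N P \<tau>)) = r"
    using L root_cluster_join[OF Nil] by simp_all
  then have "small N (sol_at N P \<tau>) (Node [])"
    using fin less Nil by (simp add: small_Node_Nil card_join)
  from branch_unaffected[OF reg down this] * Nil show ?R
    by (auto simp: sol_at_def[of N P \<tau>])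
next
  assume R: ?R
  have f: "finite (root_cluster (sol_at N P (branch b \<tau>)))" for b
    using R fin by (cases b) auto
  have "card (root_cluster (sol_at N P (branch False \<tau>))) +
      card (root_cluster (sol_at N P (branch True \<tau>))) + (if P (\<tau> []) then 1 else 0) < N"
    using R fin less by (simp add: card_join)
  note branches_determine[OF reg down f this]
  with R show ?L using root_cluster_join[of "sol_at N P \<tau>"] by simp
qed

text \<open>The state just before the root clock rings lacks the root edge, so the volume at
  \<open>Node []\<close> is the sum over the two branches. Either side makes this sum small and
  thereby allows passing to the other.\<close>

lemma root_opens_iff:
  assumes reg: "regular N \<tau>" and "N > 0"
  shows "[] \<in> sol N \<tau> \<longleftrightarrow> (\<forall>b. finite (root_cluster (sol_at N (\<lambda>x. x < \<tau> []) (branch b \<tau>)))) \<and>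
    card (root_cluster (sol_at N (\<lambda>x. x < \<tau> []) (branch False \<tau>))) +
    card (root_cluster (sol_at N (\<lambda>x. x < \<tau> []) (branch True \<tau>))) < N" (is "_ \<longleftrightarrow> ?R")
proof -
  let ?X = "sol_at N (\<lambda>x. x < \<tau> []) \<tau>"
  have wf: "wf (dependence N \<tau>)" using reg by (auto simp: regular_def)
  have nX: "[] \<notin> ?X" by (simp add: sol_at_def)
  have "[] \<in> sol N \<tau> \<longleftrightarrow> opens N \<tau> (sol N \<tau>) []"
    using solves_sol[OF wf] by (simp add: solves_def)
  also have "\<dots> \<longleftrightarrow> small N ?X Root \<and> small N ?X (Node [])"
    by (simp add: opens_def ends_Nil sol_at_def)
  also have "\<dots> \<longleftrightarrow> small N ?X (Node [])"
    using \<open>N > 0\<close> root_cluster_closed[OF nX] by (simp add: small_def)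
  also have "small N ?X (Node []) \<longleftrightarrow> ?R"
  proof
    assume "small N ?X (Node [])"
    with branch_unaffected[OF reg _ this] nX show ?R by (simp add: small_Node_Nil all_bool_eq)
  next
    assume ?R
    then have "sub b ?X = sol_at N (\<lambda>x. x < \<tau> []) (branch b \<tau>)" for b
      by (intro branches_determine(1)[OF reg]) auto
    with \<open>?R\<close> nX show "small N ?X (Node [])" by (simp add: small_Node_Nil)
  qed
  finally show ?thesis by simp
qed

section \<open>Finite clusters of the root\<close>

text \<open>The possible finite edge sets of the root cluster, generated like binary trees;
  \<open>{}\<close> is the case of a closed root edge.\<close>

inductive rooted :: "edge set \<Rightarrow> bool" where
  rooted_empty: "rooted {}"
| rooted_join: "rooted l \<Longrightarrow> rooted r \<Longrightarrow> rooted (join l r)"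

definition rooted_sets :: "nat \<Rightarrow> edge set set" where
  "rooted_sets n = {E. rooted E \<and> card E = n}"

text \<open>These are the Catalan numbers: \<open>rooted_count_Suc\<close> is their
  recursion.\<close>

definition rooted_count :: "nat \<Rightarrow> nat" where
  "rooted_count n = card (rooted_sets n)"

lemma rooted_finite: "rooted E \<Longrightarrow> finite E"
  by (induction rule: rooted.induct) auto

text \<open>Induction on the volume, since \<open>X\<close> itself may be infinite; both branch
  clusters are strictly smaller.\<close>

lemma rooted_root_cluster: "finite (root_cluster X) \<Longrightarrow> rooted (root_cluster X)"
proof (induction "card (root_cluster X)" arbitrary: X rule: less_induct)
  case less
  show ?case
  proof (cases "[] \<in> X")
    case True
    let ?l = "root_cluster (sub False X)" and ?r = "root_cluster (sub True X)"
    have eq: "root_cluster X = join ?l ?r" by (rule root_cluster_join[OF True])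
    have fin: "finite ?l" "finite ?r" using less.prems unfolding eq by auto
    then have "card ?l < card (root_cluster X)" "card ?r < card (root_cluster X)"
      unfolding eq by (simp_all add: card_join)
    with less.hyps fin have "rooted ?l" "rooted ?r" by blast+
    then show ?thesis unfolding eq by (rule rooted_join)
  qed (simp add: root_cluster_closed rooted_empty)
qed

lemma rooted_sets_0: "rooted_sets 0 = {{}}"
  by (auto simp: rooted_sets_def rooted_empty dest: rooted_finite)

lemma rooted_sets_Suc:
  "rooted_sets (Suc n) = (\<lambda>(l, r). join l r) ` (\<Union>k\<le>n. rooted_sets k \<times> rooted_sets (n - k))"
proof
  show "rooted_sets (Suc n) \<subseteq> (\<lambda>(l, r). join l r) ` (\<Union>k\<le>n. rooted_sets k \<times> rooted_sets (n - k))"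
  proof
    fix E assume E: "E \<in> rooted_sets (Suc n)"
    then have "rooted E" "card E = Suc n" by (auto simp: rooted_sets_def)
    then obtain l r where lr: "rooted l" "rooted r" "E = join l r"
      by (cases rule: rooted.cases) auto
    then have "card l + card r = n"
      using \<open>card E = Suc n\<close> by (simp add: card_join rooted_finite)
    then have "(l, r) \<in> (\<Union>k\<le>n. rooted_sets k \<times> rooted_sets (n - k))"
      using lr by (auto simp: rooted_sets_def)
    then show "E \<in> (\<lambda>(l, r). join l r) ` (\<Union>k\<le>n. rooted_sets k \<times> rooted_sets (n - k))"
      unfolding lr(3) by (rule rev_image_eqI) simp
  qed
qed (auto simp: rooted_sets_def card_join rooted_finite intro: rooted_join)

lemma finite_rooted_sets: "finite (rooted_sets n)"
proof (induction n rule: less_induct)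
  case (less n)
  show ?case
  proof (cases n)
    case (Suc m)
    have "finite (\<Union>k\<le>m. rooted_sets k \<times> rooted_sets (m - k))"
      using less Suc by (intro finite_UN_I finite_cartesian_product) auto
    then show ?thesis unfolding Suc rooted_sets_Suc by (rule finite_imageI)
  qed (simp add: rooted_sets_0)
qed

lemma rooted_count_0: "rooted_count 0 = 1"
  by (simp add: rooted_count_def rooted_sets_0)

lemma rooted_count_Suc: "rooted_count (Suc n) = (\<Sum>k\<le>n. rooted_count k * rooted_count (n - k))"
proof -
  have "rooted_count (Suc n) = card (\<Union>k\<le>n. rooted_sets k \<times> rooted_sets (n - k))"
    unfolding rooted_count_def rooted_sets_Suc by (rule card_image) (auto simp: inj_on_def)
  also have "\<dots> = (\<Sum>k\<le>n. card (rooted_sets k \<times> rooted_sets (n - k)))"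
    by (rule card_UN_disjoint) (auto simp: finite_rooted_sets, auto simp: rooted_sets_def)
  finally show ?thesis by (simp add: rooted_count_def card_cartesian_product)
qed

lemma reach_root_cluster: "reach (root_cluster X) Root = reach X Root"
proof (rule reach_cong)
  fix e assume e: "ends e \<inter> reach X Root \<noteq> {}"
  then have "ends e \<subseteq> reach X Root" if "e \<in> X" using reach_step that by blast
  then show "e \<in> X \<longleftrightarrow> e \<in> root_cluster X" by (auto simp: cluster_edges_def)
qed

text \<open>A connected subgraph containing \<open>Root\<close> is determined by its edges, its
  vertices being those that \<open>Root\<close> reaches along them. From here on only edge sets need
  to be compared.\<close>

lemma finite_cluster_root:
  assumes C: "finite_cluster C" and Root: "Root \<in> fst C"
  shows "open_cluster X Root = C \<longleftrightarrow> root_cluster X = snd C" and "rooted (snd C)"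
proof -
  have C': "\<And>e. e \<in> snd C \<Longrightarrow> ends e \<subseteq> fst C" "\<And>x. x \<in> fst C \<Longrightarrow> (Root, x) \<in> (adjacent (snd C))\<^sup>*"
    "finite (snd C)"
    using C Root by (auto simp: finite_cluster_def cluster_def)
  have R: "reach (snd C) Root = fst C"
  proof
    show "reach (snd C) Root \<subseteq> fst C" using Root C'(1) by (rule reach_least)
    show "fst C \<subseteq> reach (snd C) Root" using C'(2) by (auto simp: reach_def)
  qed
  have "root_cluster (snd C) = snd C"
    using C'(1) by (auto simp: cluster_edges_def R)
  with rooted_root_cluster[of "snd C"] C'(3) show "rooted (snd C)" by simp
  show "open_cluster X Root = C \<longleftrightarrow> root_cluster X = snd C"
  proof
    assume "root_cluster X = snd C"
    moreover from this have "reach X Root = fst C"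
      using reach_root_cluster[of X] R by simp
    ultimately show "open_cluster X Root = C"
      by (simp add: open_cluster_eq)
  qed (auto simp: open_cluster_eq)
qed

lemma volume_eq_iff: "cluster_volume (open_cluster X Root) = enat n \<longleftrightarrow> root_cluster X \<in> rooted_sets n"
  using rooted_root_cluster[of X]
  by (auto simp: open_cluster_eq cluster_volume_def rooted_sets_def dest: rooted_finite)

section \<open>The generating function of the root clusters\<close>

lemma rooted_gf_conv_le:
  fixes x :: real assumes "x \<ge> 0"
  shows "(\<Sum>n<m. real (rooted_count (Suc n)) * x ^ n) \<le> (\<Sum>n<m. real (rooted_count n) * x ^ n)\<^sup>2"
proof -
  let ?a = "\<lambda>n. real (rooted_count n) * x ^ n"
  have "(\<Sum>n<m. real (rooted_count (Suc n)) * x ^ n) = (\<Sum>n<m. \<Sum>k\<le>n. ?a k * ?a (n - k))"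
    by (auto simp: rooted_count_Suc sum_distrib_right simp flip: power_add intro!: sum.cong)
  also have "\<dots> = (\<Sum>(i, j)\<in>{(i, j). i + j < m}. ?a i * ?a j)"
    by (rule sum.triangle_reindex[symmetric])
  \<comment> \<open>The triangle \<open>i + j < m\<close> lies in the square, and all terms are
    nonnegative.\<close>
  also have "\<dots> \<le> (\<Sum>(i, j)\<in>{..<m} \<times> {..<m}. ?a i * ?a j)"
    using assms by (intro sum_mono2) auto
  also have "\<dots> = (\<Sum>n<m. ?a n)\<^sup>2"
    by (simp add: power2_eq_square sum_product sum.cartesian_product)
  finally show ?thesis .
qed

lemma rooted_gf_partial_Suc:
  fixes x :: real
  shows "(\<Sum>n<Suc m. real (rooted_count n) * x ^ n) = 1 + x * (\<Sum>n<m. real (rooted_count (Suc n)) * x ^ n)"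
  by (subst sum.lessThan_Suc_shift) (simp add: rooted_count_0 sum_distrib_left mult_ac)

text \<open>The parametrization \<open>x = t (1 - t)\<close> rationalizes the generating function.\<close>

lemma rooted_gf_partial_le:
  fixes t :: real assumes "0 \<le> t" "t \<le> 1/2"
  shows "(\<Sum>n<m. real (rooted_count n) * (t * (1 - t)) ^ n) \<le> 1 / (1 - t)"
proof (induction m)
  case 0 show ?case using assms by simp
next
  case (Suc m)
  let ?x = "t * (1 - t)" and ?S = "\<Sum>n<m. real (rooted_count n) * (t * (1 - t)) ^ n"
  have x: "?x \<ge> 0" using assms by simp
  have S: "?S \<ge> 0" using x by (intro sum_nonneg) simp
  have "(\<Sum>n<m. real (rooted_count (Suc n)) * ?x ^ n) \<le> ?S\<^sup>2" using x by (rule rooted_gf_conv_le)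
  also have "\<dots> \<le> (1 / (1 - t))\<^sup>2" using Suc S by (rule power_mono)
  finally have "(\<Sum>n<Suc m. real (rooted_count n) * ?x ^ n) \<le> 1 + ?x * (1 / (1 - t))\<^sup>2"
    unfolding rooted_gf_partial_Suc using x by (intro add_left_mono mult_left_mono)
  also have "\<dots> = 1 / (1 - t)"
  proof -
    have "?x * (1 / (1 - t))\<^sup>2 = t / (1 - t)"
      using assms by (simp add: power2_eq_square)
    then show ?thesis using assms by (simp add: field_simps)
  qed
  finally show ?case .
qed

text \<open>The Catalan recursion gives the sum the equation \<open>C = 1 + x * C\<^sup>2\<close>,
  whose roots are \<open>1 / t\<close> and \<open>1 / (1 - t)\<close>; the bound on the partial sums
  selects the smaller one.\<close>

lemma rooted_gf:
  fixes t :: real assumes t: "0 \<le> t" "t \<le> 1/2"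
  shows "(\<lambda>n. real (rooted_count n) * (t * (1 - t)) ^ n) sums (1 / (1 - t))"
    and "(\<lambda>n. real (rooted_count (Suc n)) * (t * (1 - t)) ^ n) sums (1 / (1 - t))\<^sup>2"
proof -
  let ?x = "t * (1 - t)" and ?a = "\<lambda>n. real (rooted_count n) * (t * (1 - t)) ^ n"
  have x: "?x \<ge> 0" using t by simp
  have sm: "summable ?a"
    by (rule summableI_nonneg_bounded[of _ "1 / (1 - t)"]) (use x rooted_gf_partial_le[OF t] in auto)
  define C where "C = suminf ?a"
  have "(\<lambda>n. \<Sum>k\<le>n. ?a k * ?a (n - k)) sums (C * C)"
    unfolding C_def using sm x by (intro Cauchy_product_sums) (simp_all add: abs_mult)
  also have "(\<lambda>n. \<Sum>k\<le>n. ?a k * ?a (n - k)) = (\<lambda>n. real (rooted_count (Suc n)) * ?x ^ n)"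
    by (auto simp: rooted_count_Suc sum_distrib_right simp flip: power_add intro!: sum.cong)
  finally have sq: "(\<lambda>n. real (rooted_count (Suc n)) * ?x ^ n) sums C\<^sup>2"
    by (simp add: power2_eq_square)
  then have "(\<lambda>n. ?x * (real (rooted_count (Suc n)) * ?x ^ n)) sums (?x * C\<^sup>2)" by (rule sums_mult)
  also have "(\<lambda>n. ?x * (real (rooted_count (Suc n)) * ?x ^ n)) = (\<lambda>n. ?a (Suc n))"
    by (simp add: mult_ac)
  finally have "?a sums (?x * C\<^sup>2 + ?a 0)" by (rule sums_Suc)
  then have "C = ?x * C\<^sup>2 + 1"
    unfolding C_def by (simp add: sums_iff rooted_count_0)
  then have "(t * C - 1) * ((1 - t) * C - 1) = 0" by (simp add: algebra_simps power2_eq_square)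
  moreover have le: "C \<le> 1 / (1 - t)"
    unfolding C_def by (rule suminf_le_const[OF sm]) (rule rooted_gf_partial_le[OF t])
  ultimately have C: "C = 1 / (1 - t)"
  proof (cases "(1 - t) * C = 1")
    case False
    then have tC: "t * C = 1"
      using \<open>(t * C - 1) * ((1 - t) * C - 1) = 0\<close> by simp
    then have "t > 0" using t by (cases "t = 0") auto
    then have "C = 1 / t" using tC by (simp add: field_simps)
    \<comment> \<open>The root \<open>1 / t\<close> respects the bound only for
      \<open>t = 1/2\<close>, where the two roots coincide.\<close>
    with le t \<open>t > 0\<close> have "1 - t = t" by (simp add: field_simps)
    with \<open>C = 1 / t\<close> show ?thesis by simp
  qed (use t in \<open>simp add: field_simps\<close>)
  show "?a sums (1 / (1 - t))" using sm by (simp add: sums_iff C flip: C_def)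
  show "(\<lambda>n. real (rooted_count (Suc n)) * ?x ^ n) sums (1 / (1 - t))\<^sup>2" using sq by (simp only: C)
qed

lemma rooted_gf_quarter:
  "(\<lambda>n. real (rooted_count n) * (1/4) ^ n) sums (2::real)"
  "(\<lambda>n. real (rooted_count (Suc n)) * (1/4) ^ n) sums (4::real)"
  using rooted_gf[of "1/2"] by (simp_all add: power2_eq_square)

section \<open>The equation for the probability that the root edge is closed\<close>

text \<open>After the last time with \<open>f \<le> 0\<close> the function is positive, so its
  derivative is nonpositive there and the mean value theorem rules out any growth. The sign of
  \<open>f'\<close> is therefore asked for only where \<open>f > 0\<close>.\<close>

lemma nonpos_by_derivative:
  fixes f f' :: "real \<Rightarrow> real"
  assumes ab: "a \<le> b" and cont: "continuous_on {a..b} f"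
    and deriv: "\<And>s. a < s \<Longrightarrow> s < b \<Longrightarrow> (f has_real_derivative f' s) (at s)"
    and init: "f a \<le> 0" and nonpos: "\<And>s. a < s \<Longrightarrow> s < b \<Longrightarrow> f s > 0 \<Longrightarrow> f' s \<le> 0"
  shows "f b \<le> 0"
proof (rule ccontr)
  assume "\<not> f b \<le> 0"
  define Z where "Z = {s \<in> {a..b}. f s \<le> 0}"
  have Z: "closed Z" "a \<in> Z" "bdd_above Z"
    using continuous_on_closed_Collect_le[OF cont continuous_on_const] ab init
    by (auto simp: Z_def)
  define s where "s = Sup Z"
  have s: "s \<in> Z" unfolding s_def using Z by (intro closed_contains_Sup) auto
  then have "s < b" "a \<le> s" "f s \<le> 0" using \<open>\<not> f b \<le> 0\<close> by (auto simp: Z_def order_less_le)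
  have pos: "f r > 0" if "s < r" "r \<le> b" for r
    using that cSup_upper[of r Z] Z(3) \<open>a \<le> s\<close> by (force simp: Z_def s_def)
  have "continuous_on {s..b} f" using \<open>a \<le> s\<close> by (intro continuous_on_subset[OF cont]) auto
  then obtain r where r: "s < r" "r < b" "f b - f s = (b - s) * f' r"
    using mvt[OF \<open>s < b\<close>, of f "\<lambda>x. (*) (f' x)"] deriv \<open>a \<le> s\<close>
    by (auto simp: has_field_derivative_def mult.commute)
  then have "f' r \<le> 0" using nonpos pos \<open>a \<le> s\<close> by simp
  then have "(b - s) * f' r \<le> 0" using \<open>s < b\<close> by (simp add: mult_nonneg_nonpos)
  with r(3) \<open>f s \<le> 0\<close> \<open>\<not> f b \<le> 0\<close> show False by linarith
qed

text \<open>The polynomial F_N; its coefficient at \<open>x ^ n\<close> counts the pairs of branch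
  clusters with \<open>n\<close> edges in total.\<close>

definition branch_gf :: "nat \<Rightarrow> real \<Rightarrow> real" where
  "branch_gf N x = (\<Sum>n<N. real (rooted_count (Suc n)) * x ^ n)"

lemma branch_gf_mono: "0 \<le> x \<Longrightarrow> x \<le> y \<Longrightarrow> branch_gf N x \<le> branch_gf N y"
  unfolding branch_gf_def by (intro sum_mono mult_left_mono power_mono) auto

lemma branch_gf_nonneg: "0 \<le> x \<Longrightarrow> 0 \<le> branch_gf N x"
  unfolding branch_gf_def by (intro sum_nonneg) auto

text \<open>Truncation error at the critical point 1/4, where the full series has the value
  4.\<close>

definition gf_gap :: "nat \<Rightarrow> real" where
  "gf_gap N = 4 - branch_gf N (1/4)"

lemma gf_gap_tendsto: "gf_gap \<longlonglongrightarrow> 0"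
  using tendsto_diff[OF tendsto_const rooted_gf_quarter(2)[unfolded sums_def], of 4]
  by (simp add: gf_gap_def[abs_def] branch_gf_def)

text \<open>The remainder has nonnegative coefficients, so it is at most its value at 1/4, the
  maximum of \<open>t * (1 - t)\<close>.\<close>

lemma branch_gf_gap:
  assumes t: "0 \<le> t" "t \<le> 1/2"
  shows "branch_gf N (t * (1 - t)) \<le> (1 / (1 - t))\<^sup>2"
    and "(1 / (1 - t))\<^sup>2 - branch_gf N (t * (1 - t)) \<le> gf_gap N"
proof -
  let ?x = "t * (1 - t)"
  have x: "0 \<le> ?x" "?x \<le> 1/4"
    using t zero_le_square[of "t - 1/2"] by (simp, simp add: algebra_simps)
  let ?f = "\<lambda>x n. real (rooted_count (Suc n)) * x ^ n :: real"
  have sums: "(\<lambda>n. ?f ?x (n + N)) sums ((1 / (1 - t))\<^sup>2 - branch_gf N ?x)"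
    "(\<lambda>n. ?f (1/4) (n + N)) sums (4 - branch_gf N (1/4))"
    using sums_split_initial_segment[OF rooted_gf(2)[OF t], of N]
      sums_split_initial_segment[OF rooted_gf_quarter(2), of N]
    by (simp_all add: branch_gf_def)
  show "branch_gf N ?x \<le> (1 / (1 - t))\<^sup>2"
    using sums_le[OF _ sums_zero sums(1)] x(1) by simp
  show "(1 / (1 - t))\<^sup>2 - branch_gf N ?x \<le> gf_gap N"
    unfolding gf_gap_def
    by (rule sums_le[OF _ sums]) (intro mult_left_mono power_mono x, simp)
qed

text \<open>The tail of the Catalan series at 1/4, whose sum is 2.\<close>

definition cluster_tail :: "nat \<Rightarrow> real" where
  "cluster_tail k = 2 - (\<Sum>n<k. real (rooted_count n) * (1/4) ^ n)"

lemma cluster_tail_tendsto: "cluster_tail \<longlonglongrightarrow> 0"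
  using tendsto_diff[OF tendsto_const rooted_gf_quarter(1)[unfolded sums_def], of 2]
  by (simp add: cluster_tail_def[abs_def])

lemma cluster_tail_nonneg: "cluster_tail k \<ge> 0"
  using sum_le_suminf[OF sums_summable[OF rooted_gf_quarter(1)], of "{..<k}"]
  by (simp add: cluster_tail_def sums_unique[OF rooted_gf_quarter(1), symmetric])

lemma aldous_beta_bounds:
  assumes "0 \<le> t" "t \<le> 1"
  shows "0 \<le> aldous_beta t" "aldous_beta t \<le> 1" "t * aldous_beta t \<le> 1/4"
  using assms sum_squares_bound[of t "1 - t"]
  by (auto simp: aldous_beta_def field_simps power2_eq_square)

text \<open>The case distinction is minus the derivative of \<open>aldous_beta\<close>, so this is
  the differential equation for the limit, up to the truncation of the series.\<close>

lemma branch_gf_aldous: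
  assumes s: "0 \<le> s" "s \<le> 1"
  shows "(aldous_beta s)\<^sup>2 * branch_gf N (s * aldous_beta s) \<le> (if s \<le> 1/2 then 1 else 1 / (4 * s\<^sup>2))"
    and "(if s \<le> 1/2 then 1 else 1 / (4 * s\<^sup>2)) -
      (aldous_beta s)\<^sup>2 * branch_gf N (s * aldous_beta s) \<le> gf_gap N"
proof -
  \<comment> \<open>For \<open>s > 1/2\<close> the product \<open>s * aldous_beta s\<close> stays at
    1/4, which corresponds to the parameter 1/2.\<close>
  define r where "r = (if s \<le> 1/2 then s else 1/2)"
  have r: "0 \<le> r" "r \<le> 1/2" using s by (auto simp: r_def)
  have eq: "s * aldous_beta s = r * (1 - r)"
    by (auto simp: r_def aldous_beta_def)
  have D: "(if s \<le> 1/2 then 1 else 1 / (4 * s\<^sup>2)) = (aldous_beta s)\<^sup>2 * (1 / (1 - r))\<^sup>2"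
  proof (cases "s \<le> 1/2")
    case True
    then show ?thesis by (simp add: r_def aldous_beta_def power_divide)
  next
    case False
    then show ?thesis by (simp add: r_def aldous_beta_def power2_eq_square)
  qed
  have sq: "0 \<le> (aldous_beta s)\<^sup>2" "(aldous_beta s)\<^sup>2 \<le> 1"
    using aldous_beta_bounds[OF s] by (simp_all add: power_le_one)
  note gap = branch_gf_gap[OF r, of N]
  show "(aldous_beta s)\<^sup>2 * branch_gf N (s * aldous_beta s) \<le> (if s \<le> 1/2 then 1 else 1 / (4 * s\<^sup>2))"
    unfolding D eq using gap(1) sq(1) by (rule mult_left_mono)
  have "(aldous_beta s)\<^sup>2 * ((1 / (1 - r))\<^sup>2 - branch_gf N (r * (1 - r))) \<le> 1 * gf_gap N"
    using gap sq by (intro mult_mono) auto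
  then show "(if s \<le> 1/2 then 1 else 1 / (4 * s\<^sup>2)) -
      (aldous_beta s)\<^sup>2 * branch_gf N (s * aldous_beta s) \<le> gf_gap N"
    unfolding D eq by (simp add: algebra_simps)
qed

lemma aldous_beta_deriv:
  assumes "s \<noteq> 1/2" "0 < s"
  shows "(aldous_beta has_real_derivative - (if s \<le> 1/2 then 1 else 1 / (4 * s\<^sup>2))) (at s)"
proof (cases "s < 1/2")
  case True
  have "((\<lambda>t. 1 - t) has_real_derivative - 1) (at s)"
    by (auto intro!: derivative_eq_intros)
  then have "(aldous_beta has_real_derivative - 1) (at s)"
    by (rule DERIV_cong_ev[OF refl _ refl, THEN iffD1, rotated])
      (use True in \<open>auto simp: aldous_beta_def eventually_nhds intro!: exI[of _ "{..<1/2}"]\<close>)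
  with True show ?thesis by simp
next
  case False
  have "((\<lambda>t. 1 / (4 * t)) has_real_derivative - (1 / (4 * s\<^sup>2))) (at s)"
    using assms by (auto intro!: derivative_eq_intros simp: power2_eq_square field_simps)
  then have "(aldous_beta has_real_derivative - (1 / (4 * s\<^sup>2))) (at s)"
    by (rule DERIV_cong_ev[OF refl _ refl, THEN iffD1, rotated])
      (use False assms in \<open>auto simp: aldous_beta_def eventually_nhds intro!: exI[of _ "{1/2<..}"]\<close>)
  with False assms show ?thesis by simp
qed

lemma aldous_beta_cont: "continuous_on {0..1} aldous_beta"
proof -
  have eq: "{0..1::real} = {0..1/2} \<union> {1/2..1}" by auto
  show ?thesis
    unfolding eq aldous_beta_def[abs_def]
  proof (rule continuous_on_If)
    fix x :: real assume "x \<in> {1/2..1}" "x \<le> 1/2"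
    then have x: "x = 1/2" by simp
    show "1 - x = 1 / (4 * x)" unfolding x by simp
  qed (auto intro!: continuous_intros)
qed

text \<open>Isolates what the analysis needs to know about the closing probability;
  \<open>closed_at N\<close> becomes an instance once the equation is derived.\<close>

locale closed_ode =
  fixes N :: nat and b :: "real \<Rightarrow> real"
  assumes init: "b 0 = 1"
    and cont: "continuous_on {0..1} b"
    and deriv: "\<And>s. 0 < s \<Longrightarrow> s < 1 \<Longrightarrow>
      (b has_real_derivative - ((b s)\<^sup>2 * branch_gf N (s * b s))) (at s)"
    and nonneg: "\<And>s. 0 \<le> s \<Longrightarrow> s \<le> 1 \<Longrightarrow> 0 \<le> b s"
    and le_1: "\<And>s. 0 \<le> s \<Longrightarrow> s \<le> 1 \<Longrightarrow> b s \<le> 1"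
begin

text \<open>The derivative of \<^const>\<open>aldous_beta\<close> at the kink \<open>1/2\<close> of its definition is avoided.\<close>

lemma compare:
  fixes f :: "real \<Rightarrow> real"
  assumes t: "0 \<le> t" "t \<le> 1" and f: "continuous_on {0..1} f" "f 0 \<le> 0"
    and deriv: "\<And>s. 0 < s \<Longrightarrow> s < 1 \<Longrightarrow> s \<noteq> 1/2 \<Longrightarrow> (f has_real_derivative f' s) (at s)"
    and nonpos: "\<And>s. 0 < s \<Longrightarrow> s < 1 \<Longrightarrow> f s > 0 \<Longrightarrow> f' s \<le> 0"
  shows "f t \<le> 0"
proof (cases "t \<le> 1/2")
  case True
  show ?thesis
    by (rule nonpos_by_derivative[of 0 t f f'])
      (use t f True deriv nonpos in \<open>auto intro: continuous_on_subset\<close>)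
next
  case False
  have "f (1/2) \<le> 0"
    by (rule nonpos_by_derivative[of 0 "1/2" f f'])
      (use f deriv nonpos in \<open>auto intro: continuous_on_subset\<close>)
  then show ?thesis
    by (intro nonpos_by_derivative[of "1/2" t f f'])
      (use t f False deriv nonpos in \<open>auto intro: continuous_on_subset\<close>)
qed

text \<open>Where \<open>b\<close> is below \<open>aldous_beta\<close>, monotonicity of the
  truncated series and its bound by the full one make \<open>b\<close> decay no faster, so the
  difference cannot grow.\<close>

lemma lower:
  assumes t: "0 \<le> t" "t \<le> 1" shows "aldous_beta t \<le> b t"
proof -
  let ?D = "\<lambda>s::real. if s \<le> 1/2 then 1 else 1 / (4 * s\<^sup>2)"
  have "aldous_beta t - b t \<le> 0"
  proof (rule compare[where f' = "\<lambda>s. - ?D s - - ((b s)\<^sup>2 * branch_gf N (s * b s))", OF t])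
    show "continuous_on {0..1} (\<lambda>s. aldous_beta s - b s)"
      by (intro continuous_intros aldous_beta_cont cont)
    show "aldous_beta 0 - b 0 \<le> 0" by (simp add: init aldous_beta_def)
    fix s :: real assume s: "0 < s" "s < 1"
    show "((\<lambda>s. aldous_beta s - b s) has_real_derivative
        - ?D s - - ((b s)\<^sup>2 * branch_gf N (s * b s))) (at s)" if "s \<noteq> 1/2"
      using that s by (intro DERIV_diff aldous_beta_deriv deriv) auto
    assume less: "aldous_beta s - b s > 0"
    have "(b s)\<^sup>2 * branch_gf N (s * b s) \<le> (aldous_beta s)\<^sup>2 * branch_gf N (s * aldous_beta s)"
      using s less nonneg[of s] by (intro mult_mono power_mono branch_gf_mono branch_gf_nonneg) auto
    also have "\<dots> \<le> ?D s" using s by (intro branch_gf_aldous(1)) auto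
    finally show "- ?D s - - ((b s)\<^sup>2 * branch_gf N (s * b s)) \<le> 0" by simp
  qed
  then show ?thesis by simp
qed

text \<open>By \<open>lower\<close>, the decay rate of \<open>b\<close> is at least the truncated
  rate at \<open>aldous_beta\<close>, which misses the full rate by at most \<open>gf_gap N\<close>.
  Integrating this deficit gives the factor \<open>t\<close>.\<close>

lemma upper:
  assumes t: "0 \<le> t" "t \<le> 1" shows "b t \<le> aldous_beta t + gf_gap N * t"
proof -
  let ?D = "\<lambda>s::real. if s \<le> 1/2 then 1 else 1 / (4 * s\<^sup>2)"
  let ?f' = "\<lambda>s. - ((b s)\<^sup>2 * branch_gf N (s * b s)) - - ?D s - gf_gap N"
  have "b t - aldous_beta t - gf_gap N * t \<le> 0"
  proof (rule compare[where f' = ?f', OF t])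
    show "continuous_on {0..1} (\<lambda>s. b s - aldous_beta s - gf_gap N * s)"
      by (intro continuous_intros aldous_beta_cont cont)
    show "b 0 - aldous_beta 0 - gf_gap N * 0 \<le> 0" by (simp add: init aldous_beta_def)
    fix s :: real assume s: "0 < s" "s < 1"
    show "((\<lambda>s. b s - aldous_beta s - gf_gap N * s) has_real_derivative ?f' s) (at s)" if "s \<noteq> 1/2"
      using that s by (intro DERIV_diff aldous_beta_deriv deriv DERIV_cmult_Id) auto
    have "(aldous_beta s)\<^sup>2 * branch_gf N (s * aldous_beta s) \<le> (b s)\<^sup>2 * branch_gf N (s * b s)"
      using s lower[of s] aldous_beta_bounds[of s]
      by (intro mult_mono power_mono branch_gf_mono branch_gf_nonneg) auto
    moreover have "?D s - (aldous_beta s)\<^sup>2 * branch_gf N (s * aldous_beta s) \<le> gf_gap N"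
      using s by (intro branch_gf_aldous(2)) auto
    ultimately show "?f' s \<le> 0" by linarith
  qed
  then show ?thesis by simp
qed

text \<open>With \<open>x = s * b s\<close> one has \<open>x' = b s * (1 - x * branch_gf N x)\<close>.\<close>

lemma subcritical:
  assumes t: "0 \<le> t" "t \<le> 1"
  shows "t * b t * branch_gf N (t * b t) \<le> 1"
proof -
  define p where "p x = (\<Sum>n<N. real (rooted_count (Suc n)) * x ^ Suc n)" for x :: real
  define p' where "p' x = (\<Sum>n<N. real (rooted_count (Suc n)) * (real (Suc n) * x ^ n))" for x :: real
  have p: "p x = x * branch_gf N x" for x
    by (simp add: p_def branch_gf_def sum_distrib_left mult_ac)
  have dp: "(p has_real_derivative p' x) (at x)" for x
    unfolding p_def[abs_def] p'_def
    by (intro DERIV_sum DERIV_cmult) (use DERIV_pow[of "Suc _" x] in simp)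
  have "p (t * b t) - 1 \<le> 0"
  proof (rule nonpos_by_derivative[where a = 0 and f = "\<lambda>t. p (t * b t) - 1"
        and f' = "\<lambda>s. p' (s * b s) * (b s * (1 - p (s * b s)))", OF t(1)])
    have "continuous_on {0..t} b" using cont by (rule continuous_on_subset) (use t in auto)
    then show "continuous_on {0..t} (\<lambda>t. p (t * b t) - 1)"
      unfolding p_def by (intro continuous_intros)
    show "p (0 * b 0) - 1 \<le> 0" by (simp add: p)
    fix s :: real assume s: "0 < s" "s < t"
    have db: "(b has_real_derivative - ((b s)\<^sup>2 * branch_gf N (s * b s))) (at s)"
      using s t by (intro deriv) auto
    have "((\<lambda>s. s * b s) has_real_derivative b s * (1 - p (s * b s))) (at s)"
      by (rule derivative_eq_intros db refl)+ (simp add: p algebra_simps power2_eq_square)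
    from DERIV_diff[OF DERIV_chain2[OF dp this] DERIV_const]
    show "((\<lambda>t. p (t * b t) - 1) has_real_derivative p' (s * b s) * (b s * (1 - p (s * b s)))) (at s)"
      by simp
    assume "p (s * b s) - 1 > 0"
    moreover have "p' (s * b s) \<ge> 0"
      unfolding p'_def using s t nonneg[of s] by (intro sum_nonneg) auto
    moreover have "b s \<ge> 0" using s t by (intro nonneg) auto
    ultimately show "p' (s * b s) * (b s * (1 - p (s * b s))) \<le> 0"
      by (intro mult_nonneg_nonpos) auto
  qed
  then show ?thesis by (simp add: p)
qed

text \<open>Below the critical value \<open>1/4\<close> the tail increases in \<open>t * b t\<close>; above it the bound follows from
  \<open>subcritical\<close>, since the initial part of the series increases.\<close>

lemma tail_bound:
  assumes t: "0 \<le> t" "t \<le> 1"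
  shows "(\<Sum>n=k..<N. real (rooted_count n) * b t * (t * b t) ^ n) \<le> cluster_tail k"
proof -
  let ?x = "t * b t" and ?a = "\<lambda>x n. real (rooted_count n) * x ^ n :: real"
  have x: "0 \<le> ?x" using t nonneg[of t] by simp
  have a: "0 \<le> ?a ?x n" for n using x by simp
  have tail: "(\<Sum>n=k..<N. ?a ?x n) \<le> cluster_tail k"
  proof (cases "k \<le> N")
    case False then show ?thesis by (simp add: cluster_tail_nonneg)
  next
    case k: True
    show ?thesis
    proof (cases "?x \<le> 1/4")
      case True
      have "(\<Sum>n=k..<N. ?a ?x n) \<le> (\<Sum>n=k..<N. ?a (1/4) n)"
        using x True by (intro sum_mono mult_left_mono power_mono) auto
      also have "\<dots> = (\<Sum>n<N. ?a (1/4) n) - (\<Sum>n<k. ?a (1/4) n)"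
        using k by (simp add: sum_diff_nat_ivl[of 0 k N, symmetric] atLeast0LessThan)
      also have "\<dots> \<le> cluster_tail k"
        using cluster_tail_nonneg[of N] by (simp add: cluster_tail_def)
      finally show ?thesis .
    next
      case False
      have "(\<Sum>n=k..<N. ?a ?x n) = (\<Sum>n<N. ?a ?x n) - (\<Sum>n<k. ?a ?x n)"
        using k by (simp add: sum_diff_nat_ivl[of 0 k N, symmetric] atLeast0LessThan)
      \<comment> \<open>Adding the term \<open>n = N\<close> completes the sum to 1 + x F_N(x),
        which is at most 2, the constant in \<open>cluster_tail\<close>.\<close>
      moreover have "(\<Sum>n<N. ?a ?x n) \<le> (\<Sum>n<Suc N. ?a ?x n)" using a by simp
      moreover have "(\<Sum>n<Suc N. ?a ?x n) = 1 + ?x * branch_gf N ?x"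
        unfolding rooted_gf_partial_Suc branch_gf_def ..
      moreover have "?x * branch_gf N ?x \<le> 1" by (rule subcritical[OF t])
      moreover have "(\<Sum>n<k. ?a (1/4) n) \<le> (\<Sum>n<k. ?a ?x n)"
        using False by (intro sum_mono mult_left_mono power_mono) auto
      ultimately show ?thesis unfolding cluster_tail_def by linarith
    qed
  qed
  have "(\<Sum>n=k..<N. real (rooted_count n) * b t * ?x ^ n) = b t * (\<Sum>n=k..<N. ?a ?x n)"
    by (simp add: sum_distrib_left mult_ac)
  also have "\<dots> \<le> 1 * (\<Sum>n=k..<N. ?a ?x n)"
    using le_1[of t] t a by (intro mult_right_mono sum_nonneg) auto
  finally show ?thesis using tail by simp
qed

end

section \<open>Convergence of the cluster weights\<close>

context
  fixes b :: "nat \<Rightarrow> real \<Rightarrow> real" and t :: real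
  assumes ode: "\<And>N. N > 0 \<Longrightarrow> closed_ode N (b N)" and t: "0 \<le> t" "t \<le> 1"
begin

lemma closed_tendsto: "(\<lambda>N. b N t) \<longlonglongrightarrow> aldous_beta t"
proof (rule real_tendsto_sandwich)
  show "\<forall>\<^sub>F N in sequentially. aldous_beta t \<le> b N t"
    using eventually_gt_at_top[of 0] by eventually_elim (use closed_ode.lower[OF ode] t in blast)
  show "\<forall>\<^sub>F N in sequentially. b N t \<le> aldous_beta t + gf_gap N * t"
    using eventually_gt_at_top[of 0] by eventually_elim (use closed_ode.upper[OF ode] t in blast)
  show "(\<lambda>N. aldous_beta t + gf_gap N * t) \<longlonglongrightarrow> aldous_beta t"
    by (rule tendsto_eq_intros gf_gap_tendsto refl | simp)+
qed simp

lemma weight_tendsto: "(\<lambda>N. b N t * (t * b N t) ^ n) \<longlonglongrightarrow> aldous_beta t * (t * aldous_beta t) ^ n"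
  by (intro tendsto_intros closed_tendsto)

lemma aldous_weight_summable:
  "summable (\<lambda>n. real (rooted_count n) * aldous_beta t * (t * aldous_beta t) ^ n)"
proof (rule summable_comparison_test')
  show "summable (\<lambda>n. real (rooted_count n) * (1/4) ^ n :: real)"
    using rooted_gf_quarter(1) by (rule sums_summable)
  fix n
  note bd = aldous_beta_bounds[OF t]
  have "aldous_beta t * (t * aldous_beta t) ^ n \<le> 1 * (1/4) ^ n"
    using bd t by (intro mult_mono power_mono) auto
  then have "real (rooted_count n) * (aldous_beta t * (t * aldous_beta t) ^ n) \<le> real (rooted_count n) * (1/4) ^ n"
    by (intro mult_left_mono) auto
  then show "norm (real (rooted_count n) * aldous_beta t * (t * aldous_beta t) ^ n) \<le> real (rooted_count n) * (1/4) ^ n"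
    using bd t by (simp add: mult_ac abs_mult)
qed

text \<open>The number of terms grows with \<open>N\<close>, so termwise convergence is not enough.
  The differences are nonnegative by \<open>lower\<close>; beyond a fixed \<open>k\<close> they are
  bounded by \<open>cluster_tail k\<close>, uniformly in \<open>N\<close>.\<close>

lemma total_weight_tendsto:
  "(\<lambda>N. \<Sum>n<N. real (rooted_count n) * b N t * (t * b N t) ^ n)
     \<longlonglongrightarrow> (\<Sum>n. real (rooted_count n) * aldous_beta t * (t * aldous_beta t) ^ n)"
proof -
  let ?w = "\<lambda>\<beta> n. real (rooted_count n) * \<beta> * (t * \<beta>) ^ n :: real"
  define d where "d N n = ?w (b N t) n - ?w (aldous_beta t) n" for N n
  have d_nonneg: "0 \<le> d N n" if "N > 0" for N n
    unfolding d_def using closed_ode.lower[OF ode[OF that] t] aldous_beta_bounds(1)[OF t] t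
    by (simp, intro mult_mono power_mono mult_nonneg_nonneg) auto
  have lim: "(\<lambda>N. \<Sum>n<k. d N n) \<longlonglongrightarrow> 0" for k
  proof -
    have "(\<lambda>N. ?w (b N t) n) \<longlonglongrightarrow> ?w (aldous_beta t) n" for n
      by (intro tendsto_intros closed_tendsto)
    then have "(\<lambda>N. d N n) \<longlonglongrightarrow> ?w (aldous_beta t) n - ?w (aldous_beta t) n" for n
      unfolding d_def by (intro tendsto_diff tendsto_const)
    then have "(\<lambda>N. d N n) \<longlonglongrightarrow> 0" for n by simp
    then have "(\<lambda>N. \<Sum>n<k. d N n) \<longlonglongrightarrow> (\<Sum>n<k. 0)" by (intro tendsto_sum)
    then show ?thesis by simp
  qed
  have "(\<lambda>N. \<Sum>n<N. d N n) \<longlonglongrightarrow> 0"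
  proof (rule LIMSEQ_I)
    fix e :: real assume "e > 0"
    then have "\<forall>\<^sub>F k in sequentially. cluster_tail k < e / 2"
      using order_tendstoD(2)[OF cluster_tail_tendsto, of "e / 2"] by simp
    then obtain k where k: "cluster_tail k < e / 2"
      by (meson eventually_happens trivial_limit_sequentially)
    have "\<forall>\<^sub>F N in sequentially. (\<Sum>n<k. d N n) < e / 2"
      using order_tendstoD(2)[OF lim, of "e / 2" k] \<open>e > 0\<close> by simp
    then have "\<forall>\<^sub>F N in sequentially. norm ((\<Sum>n<N. d N n) - 0) < e"
      using eventually_gt_at_top[of 0] eventually_ge_at_top[of k]
    proof eventually_elim
      case (elim N)
      have "(\<Sum>n=k..<N. d N n) \<le> (\<Sum>n=k..<N. ?w (b N t) n)"
        unfolding d_def using aldous_beta_bounds(1)[OF t] t by (intro sum_mono) simp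
      also have "\<dots> \<le> cluster_tail k"
        using elim(2) by (intro closed_ode.tail_bound[OF ode] t)
      finally have "(\<Sum>n=k..<N. d N n) < e / 2" using k by linarith
      moreover have "(\<Sum>n<N. d N n) = (\<Sum>n<k. d N n) + (\<Sum>n=k..<N. d N n)"
        using elim(3) sum.atLeastLessThan_concat[of 0 k N "d N"] by (simp add: atLeast0LessThan)
      moreover have "0 \<le> (\<Sum>n<N. d N n)" using d_nonneg[OF elim(2)] by (intro sum_nonneg)
      ultimately show ?case using elim(1) by simp
    qed
    then show "\<exists>no. \<forall>N\<ge>no. norm ((\<Sum>n<N. d N n) - 0) < e"
      by (simp add: eventually_sequentially)
  qed
  from tendsto_add[OF this summable_LIMSEQ[OF aldous_weight_summable]]
  show ?thesis by (simp add: d_def sum_subtractf)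
qed

end

section \<open>The law of the clocks\<close>

definition unif :: "real measure" where
  "unif = uniform_measure lborel {0..1}"

definition clock_law :: "(edge \<Rightarrow> real) measure" where
  "clock_law = PiM UNIV (\<lambda>_. unif)"

lemma prob_space_unif: "prob_space unif"
  unfolding unif_def by (rule prob_space_uniform_measure) auto

lemma sets_unif [simp, measurable_cong]: "sets unif = sets borel"
  by (simp add: unif_def)

lemma space_unif [simp]: "space unif = UNIV"
  by (simp add: unif_def)

lemma emeasure_unif: "A \<in> sets borel \<Longrightarrow> emeasure unif A = emeasure lborel ({0..1} \<inter> A)"
  by (simp add: unif_def divide_ennreal_def)

interpretation unif: prob_space unif
  by (rule prob_space_unif)

interpretation clocks: product_prob_space "\<lambda>_::edge. unif" UNIV
  by unfold_locales

interpretation clock_law: prob_space clock_law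
  unfolding clock_law_def by (rule clocks.P.prob_space_axioms)

lemma space_clock_law [simp]: "space clock_law = UNIV"
  by (simp add: clock_law_def space_PiM PiE_UNIV_domain)

lemma sets_clock_law: "sets clock_law = sets (PiM UNIV (\<lambda>_. borel))"
  unfolding clock_law_def by (rule sets_PiM_cong) auto

lemma measurable_clock [measurable]: "(\<lambda>\<omega>. \<omega> e) \<in> borel_measurable clock_law"
  by (simp add: measurable_cong_sets[OF sets_clock_law refl])

lemma measurable_into_clock_law:
  assumes "\<And>e. (\<lambda>x. f x e) \<in> borel_measurable M"
  shows "f \<in> measurable M clock_law"
  unfolding measurable_cong_sets[OF refl sets_clock_law]
  by (rule measurable_PiM_single') (use assms in auto)

lemma emeasure_clocks:
  assumes "finite J" "\<And>e. e \<in> J \<Longrightarrow> F e \<in> sets borel"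
  shows "emeasure clock_law {\<omega>. \<forall>e\<in>J. \<omega> e \<in> F e} = (\<Prod>e\<in>J. emeasure unif (F e))"
  using clocks.emeasure_PiM_Collect[of J F] assms
  by (simp flip: clock_law_def)

lemma AE_clock:
  assumes "AE x in unif. Q x" shows "AE \<omega> in clock_law. Q (\<omega> e)"
  unfolding clock_law_def by (rule clocks.AE_component) (use assms in auto)

lemma emeasure_unif_le: "emeasure unif {a..<b} \<le> ennreal (b - a)"
proof (cases "a \<le> b")
  case True
  have "emeasure unif {a..<b} = emeasure lborel ({0..1} \<inter> {a..<b})"
    by (simp add: emeasure_unif)
  also have "\<dots> \<le> emeasure lborel {a..<b}" by (rule emeasure_mono) auto
  finally show ?thesis using True by simp
qed simp

lemma measure_unif_atMost: "0 \<le> t \<Longrightarrow> t \<le> 1 \<Longrightarrow> measure unif {x. x \<le> t} = t"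
proof -
  assume t: "0 \<le> t" "t \<le> 1"
  then have "{0..1} \<inter> {x. x \<le> t} = {0..t}" by auto
  with t show ?thesis by (simp add: measure_def emeasure_unif)
qed

lemma AE_unif_range: "AE x in unif. 0 \<le> x \<and> x \<le> 1"
  unfolding unif_def by (rule AE_uniform_measureI) auto

lemma AE_unif_neq: "AE x in unif. x \<noteq> c"
  unfolding unif_def using AE_lborel_singleton[of c] by (intro AE_uniform_measureI) auto

lemma branch_distr: "distr clock_law clock_law (branch b) = clock_law"
  using distr_PiM_reindex[of UNIV "\<lambda>_. unif" "\<lambda>e. e @ [b]" UNIV] inj_append[of b UNIV]
  by (simp add: clock_law_def branch_def[abs_def] prob_space_unif restrict_UNIV)

lemma measurable_branch [measurable]: "branch b \<in> measurable clock_law clock_law"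
  by (rule measurable_into_clock_law) (simp add: branch_def)

section \<open>Almost surely there are no infinite chains of dependent edges\<close>

fun paths :: "nat \<Rightarrow> nat \<Rightarrow> edge \<Rightarrow> edge list set" where
  "paths N 0 e = {[e]}"
| "paths N (Suc m) e = (\<Union>g\<in>near N e. (#) e ` paths N m g)"

lemma paths_length: "xs \<in> paths N m e \<Longrightarrow> length xs = Suc m"
  by (induction m arbitrary: e xs) auto

lemma paths_card: "finite (paths N m e) \<and> card (paths N m e) \<le> (6 * 7 ^ N) ^ m"
proof (induction m arbitrary: e)
  case (Suc m)
  have "card (paths N (Suc m) e) \<le> (\<Sum>g\<in>near N e. card ((#) e ` paths N m g))"
    using near_card(1) by (simp add: card_UN_le)
  also have "\<dots> \<le> (\<Sum>g\<in>near N e. (6 * 7 ^ N) ^ m)"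
    using Suc by (intro sum_mono) (simp add: card_image)
  also have "\<dots> \<le> (6 * 7 ^ N) * (6 * 7 ^ N) ^ m"
    using near_card(2)[of N e] by (simp del: power_mult_distrib)
  finally show ?case using Suc near_card(1) by simp
qed simp

lemma chain_path:
  assumes "\<And>i. f (Suc i) \<in> near N (f i)"
  shows "map f [n..<Suc (n + m)] \<in> paths N m (f n)"
proof (induction m arbitrary: n)
  case (Suc m)
  have "[n..<Suc (n + Suc m)] = n # [Suc n..<Suc (Suc n + m)]"
    by (subst upt_rec) simp
  then have "map f [n..<Suc (n + Suc m)] = f n # map f [Suc n..<Suc (Suc n + m)]" by simp
  also have "\<dots> \<in> paths N (Suc m) (f n)" using Suc[of "Suc n"] assms[of n] by (simp del: upt_Suc) blast
  finally show ?case .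
qed simp

text \<open>Distinctness makes the clocks along the path independent, so that the probabilities
  multiply.\<close>

definition slow_paths :: "nat \<Rightarrow> real set \<Rightarrow> nat \<Rightarrow> edge \<Rightarrow> (edge \<Rightarrow> real) set" where
  "slow_paths N I m e = {\<omega>. \<exists>xs\<in>paths N m e. distinct xs \<and> (\<forall>x\<in>set xs. \<omega> x \<in> I)}"

text \<open>
  The clocks along an infinite descending chain converge, so they eventually stay in a single one of
  the cells \<open>[i / L, (i + 1) / L)\<close>. For \<open>L\<close> twice the bound on the number of near edges, a path of
  \<open>m\<close> steps does so with probability at most \<open>2\<^sup>-\<^sup>m\<close>.
\<close>

lemma wf_dependence:
  assumes range: "\<And>e. 0 \<le> \<omega> e" and "L > 0"
    and cells: "\<And>i e. \<exists>m. \<omega> \<notin> slow_paths N {real i / L..<real (Suc i) / L} m e"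
  shows "wf (dependence N \<omega>)"
proof (rule ccontr)
  assume "\<not> wf (dependence N \<omega>)"
  then obtain f where f: "\<And>i. (f (Suc i), f i) \<in> dependence N \<omega>"
    unfolding wf_iff_no_infinite_down_chain by blast
  then have less: "\<omega> (f (Suc i)) < \<omega> (f i)" and near: "f (Suc i) \<in> near N (f i)" for i
    by (auto simp: dependence_def)
  have strict: "\<omega> (f j) < \<omega> (f i)" if "i < j" for i j
    using lift_Suc_mono_less[of "\<lambda>i. - \<omega> (f i)"] less that by simp
  define l where "l = (INF i. \<omega> (f i))"
  have bdd: "bdd_below (range (\<lambda>i. \<omega> (f i)))" using range by (intro bdd_belowI[of _ 0]) auto
  have l: "l \<le> \<omega> (f i)" for i unfolding l_def using bdd by (intro cINF_lower) auto
  have "0 \<le> l" unfolding l_def using range by (intro cINF_greatest) auto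
  \<comment> \<open>The index of the cell that contains the infimum of the clocks along the
    chain.\<close>
  define i where "i = nat \<lfloor>l * L\<rfloor>"
  have i: "real i \<le> l * L" "l * L < real (Suc i)"
    using \<open>0 \<le> l\<close> \<open>L > 0\<close> unfolding i_def by (auto simp: of_nat_nat, linarith)
  then have "l < real (Suc i) / L" and il: "real i / L \<le> l" using \<open>L > 0\<close> by (simp_all add: field_simps)
  then obtain n where n: "\<omega> (f n) < real (Suc i) / L"
    unfolding l_def using bdd by (subst (asm) cINF_less_iff) auto
  obtain m where m: "\<omega> \<notin> slow_paths N {real i / L..<real (Suc i) / L} m (f n)"
    using cells by blast
  let ?xs = "map f [n..<Suc (n + m)]"
  have "?xs \<in> paths N m (f n)" using near by (rule chain_path)
  moreover have "inj f" using strict by (metis injI linorder_neqE_nat order_less_irrefl)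
  then have "distinct ?xs" by (simp add: distinct_map inj_on_subset[of f UNIV] del: upt_Suc)
  moreover have "\<omega> (f j) \<in> {real i / L..<real (Suc i) / L}" if "n \<le> j" for j
  proof -
    have "\<omega> (f j) \<le> \<omega> (f n)" using strict[of n j] that by (cases "j = n") auto
    then show ?thesis using n il l[of j] by auto
  qed
  ultimately have "\<omega> \<in> slow_paths N {real i / L..<real (Suc i) / L} m (f n)"
    unfolding slow_paths_def by (intro CollectI bexI[of _ ?xs]) (auto simp del: upt_Suc)
  with m show False by contradiction
qed

lemma AE_no_slow_paths:
  assumes L: "L = 12 * 7 ^ N"
  shows "AE \<omega> in clock_law. \<exists>m. \<omega> \<notin> slow_paths N {real i / L..<real (Suc i) / L} m e"
proof -
  let ?I = "{real i / L..<real (Suc i) / L}"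
  let ?B = "\<lambda>xs. {\<omega>. \<forall>x\<in>set xs. \<omega> x \<in> ?I}"
  have "L > 0" unfolding L by simp
  have pw: "real i / L \<le> real (Suc i) / L" "real (Suc i) / L - real i / L = 1 / L"
    using \<open>L > 0\<close> by (simp_all add: field_simps)
  have S: "slow_paths N ?I m e = (\<Union>xs\<in>{xs\<in>paths N m e. distinct xs}. ?B xs)" for m
    by (auto simp: slow_paths_def)
  have B: "?B xs \<in> sets clock_law" for xs
  proof -
    have "{\<omega> \<in> space clock_law. \<forall>x\<in>set xs. \<omega> x \<in> ?I} \<in> sets clock_law" by measurable
    then show ?thesis by simp
  qed
  have fin: "finite {xs\<in>paths N m e. distinct xs}" for m using paths_card[of N m e] by simp
  have meas: "slow_paths N ?I m e \<in> sets clock_law" for m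
    unfolding S using B fin by (intro sets.finite_UN) auto
  have le: "emeasure clock_law (slow_paths N ?I m e) \<le> ennreal ((1/2) ^ m)" for m
  proof -
    have "emeasure clock_law (slow_paths N ?I m e) \<le>
        (\<Sum>xs\<in>{xs\<in>paths N m e. distinct xs}. emeasure clock_law (?B xs))"
      unfolding S by (rule emeasure_subadditive_finite) (use B fin in auto)
    also have "\<dots> \<le> (\<Sum>xs\<in>{xs\<in>paths N m e. distinct xs}. ennreal ((1 / L) ^ m))"
    proof (rule sum_mono)
      fix xs assume xs: "xs \<in> {xs \<in> paths N m e. distinct xs}"
      have "emeasure clock_law (?B xs) = emeasure unif ?I ^ card (set xs)"
        by (subst emeasure_clocks) auto
      also have "card (set xs) = Suc m" using xs paths_length by (auto simp: distinct_card)
      \<comment> \<open>A path of \<open>m\<close> steps has \<open>m + 1\<close> edges; one factor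
        is bounded by 1 to match the exponent in the number of paths.\<close>
      also have "emeasure unif ?I ^ Suc m \<le> 1 * ennreal (1 / L) ^ m"
        unfolding power_Suc using emeasure_unif_le[of "real i / L" "real (Suc i) / L"] pw(2)
        by (intro mult_mono power_mono unif.emeasure_le_1) simp_all
      finally show "emeasure clock_law (?B xs) \<le> ennreal ((1 / L) ^ m)"
        using \<open>L > 0\<close> by (simp add: ennreal_power)
    qed
    also have "\<dots> = ennreal (real (card {xs\<in>paths N m e. distinct xs}) * (1 / L) ^ m)"
      using \<open>L > 0\<close> by (simp add: ennreal_mult ennreal_of_nat_eq_real_of_nat)
    also have "\<dots> \<le> ennreal ((1/2) ^ m)"
    proof (rule ennreal_leI)
      have "card {xs\<in>paths N m e. distinct xs} \<le> (6 * 7 ^ N) ^ m"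
        using paths_card[of N m e] card_mono[of "paths N m e" "{xs\<in>paths N m e. distinct xs}"] by force
      then have "real (card {xs\<in>paths N m e. distinct xs}) \<le> (6 * 7 ^ N) ^ m"
        using of_nat_mono by fastforce
      then have "real (card {xs\<in>paths N m e. distinct xs}) * (1 / L) ^ m \<le> (6 * 7 ^ N) ^ m * (1 / L) ^ m"
        using \<open>L > 0\<close> by (intro mult_right_mono) auto
      also have "\<dots> = (1/2) ^ m" unfolding power_mult_distrib[symmetric] L by simp
      finally show "real (card {xs\<in>paths N m e. distinct xs}) * (1 / L) ^ m \<le> (1/2) ^ m" .
    qed
    finally show ?thesis .
  qed
  \<comment> \<open>Being in the events for all \<open>m\<close> at once has probability at most
    every \<open>(1/2) ^ m\<close>, hence 0.\<close>
  let ?N = "\<Inter>m. slow_paths N ?I m e"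
  have "emeasure clock_law ?N \<le> ennreal ((1/2) ^ m)" for m
    using emeasure_mono[of ?N "slow_paths N ?I m e" clock_law] meas le[of m] by (meson INF_lower UNIV_I order_trans)
  moreover have "(\<lambda>m. ennreal ((1/2) ^ m)) \<longlonglongrightarrow> ennreal 0"
    by (intro tendsto_ennrealI LIMSEQ_realpow_zero) auto
  ultimately have "emeasure clock_law ?N \<le> 0"
    by (intro LIMSEQ_le_const[of _ _ "emeasure clock_law ?N"]) auto
  then have "?N \<in> null_sets clock_law"
    using meas by (intro null_setsI sets.countable_INT) auto
  then show ?thesis by (rule AE_I') auto
qed

lemma AE_clock_range: "AE \<omega> in clock_law. \<forall>e. 0 \<le> \<omega> e \<and> \<omega> e \<le> 1"
  unfolding AE_all_countable using AE_clock[OF AE_unif_range] by simp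

lemma AE_wf_dependence: "AE \<omega> in clock_law. wf (dependence N \<omega>)"
proof -
  define L :: real where "L = 12 * 7 ^ N"
  have "AE \<omega> in clock_law. \<forall>i e. \<exists>m. \<omega> \<notin> slow_paths N {real i / L..<real (Suc i) / L} m e"
    unfolding AE_all_countable using AE_no_slow_paths[OF L_def] by blast
  with AE_clock_range show ?thesis
  proof eventually_elim
    case (elim \<omega>)
    show ?case
    proof (rule wf_dependence)
      show "0 \<le> \<omega> e" for e using elim(1) by blast
      show "L > 0" by (simp add: L_def)
      show "\<exists>m. \<omega> \<notin> slow_paths N {real i / L..<real (Suc i) / L} m e" for i e
        using elim(2) by blast
    qed
  qed
qed

lemma AE_regular: "AE \<omega> in clock_law. regular N \<omega>"
proof -
  have "AE \<omega> in clock_law. wf (dependence N (branch b \<omega>))" for b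
  proof (rule AE_distrD[OF measurable_branch])
    show "AE \<omega> in distr clock_law clock_law (branch b). wf (dependence N \<omega>)"
      unfolding branch_distr by (rule AE_wf_dependence)
  qed
  then show ?thesis
    unfolding regular_def using AE_wf_dependence by (simp add: AE_all_countable)
qed

section \<open>Measurability\<close>

text \<open>A property that reads only the finite set \<open>B\<close> is a finite union, over the
  admissible traces on \<open>B\<close>, of measurable events.\<close>

lemma pred_finite_restrict:
  assumes "finite B" "\<And>g. g \<in> B \<Longrightarrow> Measurable.pred M (\<lambda>\<omega>. g \<in> X \<omega>)"
    and Q: "\<And>Y. Q Y \<longleftrightarrow> Q (Y \<inter> B)"
  shows "Measurable.pred M (\<lambda>\<omega>. Q (X \<omega>))"
proof -
  have "Q (X \<omega>) \<longleftrightarrow> (\<exists>S\<in>{S \<in> Pow B. Q S}. \<forall>g\<in>B. g \<in> S \<longleftrightarrow> g \<in> X \<omega>)" for \<omega>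
  proof
    assume "Q (X \<omega>)"
    then show "\<exists>S\<in>{S \<in> Pow B. Q S}. \<forall>g\<in>B. g \<in> S \<longleftrightarrow> g \<in> X \<omega>"
      using Q by (intro bexI[of _ "X \<omega> \<inter> B"]) auto
  next
    assume "\<exists>S\<in>{S \<in> Pow B. Q S}. \<forall>g\<in>B. g \<in> S \<longleftrightarrow> g \<in> X \<omega>"
    then obtain S where "S \<subseteq> B" "Q S" "\<forall>g\<in>B. g \<in> S \<longleftrightarrow> g \<in> X \<omega>" by auto
    then have "X \<omega> \<inter> B = S" by blast
    then show "Q (X \<omega>)" using Q \<open>Q S\<close> by metis
  qed
  moreover have "Measurable.pred M (\<lambda>\<omega>. \<exists>S\<in>{S \<in> Pow B. Q S}. \<forall>g\<in>B. g \<in> S \<longleftrightarrow> g \<in> X \<omega>)"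
    using assms(1,2) by (intro pred_intros_finite pred_intros_logic) auto
  ultimately show ?thesis by simp
qed

lemma pred_small:
  assumes "\<And>g. Measurable.pred M (\<lambda>\<omega>. g \<in> X \<omega>)"
  shows "Measurable.pred M (\<lambda>\<omega>. small N (X \<omega>) v)"
proof -
  have "\<exists>e. v \<in> ends e"
    by (cases v) (auto simp: ends_def intro: exI[of _ "[]"])
  then obtain e where e: "v \<in> ends e" ..
  show ?thesis
  proof (rule pred_finite_restrict[where Q = "\<lambda>Y. small N Y v" and B = "near N e"])
    show "small N Y v \<longleftrightarrow> small N (Y \<inter> near N e) v" for Y
      using e by (rule small_cong) auto
  qed (use assms near_card in auto)
qed

lemma pred_iterate: "Measurable.pred clock_law (\<lambda>\<omega>. e \<in> iterate N \<omega> n)"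
proof (induction n arbitrary: e)
  case (Suc n)
  have "Measurable.pred clock_law (\<lambda>\<omega>. small N {g \<in> iterate N \<omega> n. \<omega> g < \<omega> e} v)" for v
    by (rule pred_small) (use Suc in \<open>simp, measurable\<close>)
  then have "Measurable.pred clock_law (\<lambda>\<omega>. \<forall>v\<in>ends e. small N {g \<in> iterate N \<omega> n. \<omega> g < \<omega> e} v)"
    by (intro pred_intros_finite ends_card)
  then show ?case by (simp add: opens_def)
qed simp

lemma pred_sol [measurable]: "Measurable.pred clock_law (\<lambda>\<omega>. e \<in> sol N \<omega>)"
  unfolding sol_def mem_Collect_eq using pred_iterate by measurable

lemma pred_sol_at:
  assumes [measurable]: "Measurable.pred borel P"
  shows "Measurable.pred clock_law (\<lambda>\<omega>. e \<in> sol_at N P \<omega>)"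
  unfolding sol_at_def mem_Collect_eq by measurable

text \<open>Induction on the shape \<open>E\<close> reduces the event to finitely many conditions on
  single edges.\<close>

lemma pred_root_cluster:
  assumes E: "rooted E" and X: "\<And>g. Measurable.pred M (\<lambda>\<omega>. g \<in> X \<omega>)"
  shows "Measurable.pred M (\<lambda>\<omega>. root_cluster (X \<omega>) = E)"
  using E X
proof (induction E arbitrary: X)
  case rooted_empty
  then show ?case by (simp add: root_cluster_empty_iff)
next
  case (rooted_join l r)
  have "root_cluster Y = join l r \<longleftrightarrow> [] \<in> Y \<and> root_cluster (sub False Y) = l \<and> root_cluster (sub True Y) = r" for Y
    using root_cluster_closed[of Y] root_cluster_join[of Y] Nil_in_join by (metis empty_iff join_inject)
  moreover have "\<And>g b. Measurable.pred M (\<lambda>\<omega>. g \<in> sub b (X \<omega>))"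
    using rooted_join.prems by (simp add: sub_def)
  then have "Measurable.pred M (\<lambda>\<omega>. root_cluster (sub False (X \<omega>)) = l)"
    "Measurable.pred M (\<lambda>\<omega>. root_cluster (sub True (X \<omega>)) = r)"
    by (auto intro: rooted_join.IH)
  ultimately show ?case using rooted_join.prems[of "[]"] by simp
qed

section \<open>Independence of the two branches\<close>

text \<open>Undoes the cut below the root edge: the components are the root clock and the clocks of
  the branches \<open>False\<close> and \<open>True\<close>.\<close>

definition glue :: "real \<times> (edge \<Rightarrow> real) \<times> (edge \<Rightarrow> real) \<Rightarrow> edge \<Rightarrow> real" where
  "glue z e = (if e = [] then fst z else if last e then snd (snd z) (butlast e) else fst (snd z) (butlast e))"

lemma glue_Nil [simp]: "glue (x, y) [] = x"
  by (simp add: glue_def)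

lemma branch_glue [simp]: "branch b (glue (x, p, q)) = (if b then q else p)"
  by (auto simp: branch_def glue_def fun_eq_iff)

abbreviation split_law :: "(real \<times> (edge \<Rightarrow> real) \<times> (edge \<Rightarrow> real)) measure" where
  "split_law \<equiv> unif \<Otimes>\<^sub>M (clock_law \<Otimes>\<^sub>M clock_law)"

lemma measurable_glue [measurable]: "glue \<in> measurable split_law clock_law"
proof (rule measurable_into_clock_law)
  fix e show "(\<lambda>z. glue z e) \<in> borel_measurable split_law"
    unfolding glue_def by (cases "e = []"; cases "last e") simp_all
qed

lemma measure_Times:
  assumes "prob_space A" "prob_space B" "X \<in> sets A" "Y \<in> sets B"
  shows "measure (A \<Otimes>\<^sub>M B) (X \<times> Y) = measure A X * measure B Y"
proof -
  interpret B: prob_space B by fact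
  show ?thesis using assms
    by (simp add: measure_def B.emeasure_pair_measure_Times enn2real_mult)
qed

lemma prob_space_pair: "prob_space A \<Longrightarrow> prob_space B \<Longrightarrow> prob_space (A \<Otimes>\<^sub>M B)"
proof -
  assume "prob_space A" "prob_space B"
  then interpret pair_prob_space A B by (simp add: pair_prob_space_def pair_sigma_finite_def prob_space_imp_sigma_finite)
  show ?thesis by unfold_locales
qed

lemma finite_sub: "finite J \<Longrightarrow> finite (sub b J)"
  unfolding sub_def using finite_vimageI[of J "\<lambda>e. e @ [b]"] by (simp add: inj_append vimage_def)

lemma prod_sub:
  fixes h :: "edge \<Rightarrow> 'a::comm_monoid_mult"
  assumes "finite J"
  shows "prod h J = (if [] \<in> J then h [] else 1) *
    ((\<Prod>e\<in>sub False J. h (e @ [False])) * (\<Prod>e\<in>sub True J. h (e @ [True])))"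
proof -
  let ?I = "\<lambda>b. (\<lambda>e. e @ [b]) ` sub b J"
  have im: "(\<Prod>e\<in>?I b. h e) = (\<Prod>e\<in>sub b J. h (e @ [b]))" for b
    by (simp add: prod.reindex inj_append)
  have "J - {[]} = ?I False \<union> ?I True"
  proof -
    have "e \<in> J - {[]} \<longleftrightarrow> e \<in> ?I False \<union> ?I True" for e
    proof (cases e rule: edge_cases)
      case (2 f b) then show ?thesis by (cases b) (auto simp: sub_def)
    qed auto
    then show ?thesis by blast
  qed
  then have "prod h (J - {[]}) = (\<Prod>e\<in>?I False. h e) * (\<Prod>e\<in>?I True. h e)"
    using finite_sub[OF assms] by (simp, subst prod.union_disjoint) auto
  moreover have "prod h J = (if [] \<in> J then h [] else 1) * prod h (J - {[]})"
    using assms by (simp add: prod.remove)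
  ultimately show ?thesis by (simp add: im)
qed

text \<open>A product measure is determined on cylinders, and the preimage of a cylinder is a box
  whose factors collect the constraints on the root edge and on each branch.\<close>

lemma glue_distr: "distr split_law clock_law glue = clock_law"
proof -
  have "distr split_law (PiM UNIV (\<lambda>_. unif)) glue = PiM UNIV (\<lambda>_. unif)"
  proof (rule clocks.PiM_eq)
    fix J :: "edge set" and F :: "edge \<Rightarrow> real set"
    assume J: "finite J" and "\<And>e. e \<in> J \<Longrightarrow> F e \<in> sets unif"
    then have F: "\<And>e. e \<in> J \<Longrightarrow> F e \<in> sets borel" by simp
    define X where "X = (if [] \<in> J then F [] else UNIV)"
    define Y where "Y b = {\<omega>. \<forall>e\<in>sub b J. \<omega> e \<in> F (e @ [b])}" for b
    have X: "X \<in> sets unif" using F by (simp add: X_def)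
    have Fb: "F (e @ [b]) \<in> sets borel" if "e \<in> sub b J" for e b
      using that F by (simp add: sub_def)
    have Y: "Y b \<in> sets clock_law" for b
    proof -
      have "{\<omega> \<in> space clock_law. \<forall>e\<in>sub b J. \<omega> e \<in> F (e @ [b])} \<in> sets clock_law"
      proof (intro sets.sets_Collect_finite_All finite_sub[OF J])
        fix e assume "e \<in> sub b J"
        from measurable_sets[OF measurable_clock Fb[OF this]]
        show "{\<omega> \<in> space clock_law. \<omega> e \<in> F (e @ [b])} \<in> sets clock_law"
          by (simp add: vimage_def)
      qed
      then show ?thesis by (simp add: Y_def)
    qed
    have emY: "emeasure clock_law (Y b) = (\<Prod>e\<in>sub b J. emeasure unif (F (e @ [b])))" for b
      unfolding Y_def by (rule emeasure_clocks) (use finite_sub[OF J] Fb in auto)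
    have "glue -` prod_emb UNIV (\<lambda>_. unif) J (Pi\<^sub>E J F) \<inter> space split_law = X \<times> (Y False \<times> Y True)"
    proof -
      have "z \<in> glue -` prod_emb UNIV (\<lambda>_. unif) J (Pi\<^sub>E J F) \<longleftrightarrow> z \<in> X \<times> (Y False \<times> Y True)" for z
      proof -
        obtain x p q where z: "z = (x, p, q)" by (cases z) auto
        have g: "glue z (e @ [b]) = (if b then q e else p e)" for e b
          by (simp add: z glue_def)
        have "z \<in> glue -` prod_emb UNIV (\<lambda>_. unif) J (Pi\<^sub>E J F) \<longleftrightarrow> (\<forall>e\<in>J. glue z e \<in> F e)"
          by (auto simp: prod_emb_def PiE_iff)
        also have "\<dots> \<longleftrightarrow> ([] \<in> J \<longrightarrow> x \<in> F []) \<and> (\<forall>e\<in>sub False J. p e \<in> F (e @ [False]))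
            \<and> (\<forall>e\<in>sub True J. q e \<in> F (e @ [True]))" (is "?L \<longleftrightarrow> ?R")
        proof
          assume ?L
          then show ?R using g[of _ True] g[of _ False] by (auto simp: sub_def z)
        next
          assume R: ?R
          show ?L
          proof
            fix e assume "e \<in> J"
            with R g show "glue z e \<in> F e"
              by (cases e rule: edge_cases) (auto simp: sub_def z)
          qed
        qed
        finally show ?thesis by (simp add: z X_def Y_def)
      qed
      then show ?thesis by (auto simp: space_pair_measure)
    qed
    moreover have "prod_emb UNIV (\<lambda>_. unif) J (Pi\<^sub>E J F) \<in> sets (PiM UNIV (\<lambda>_. unif))"
      using J F by (intro sets_PiM_I) auto
    ultimately have "emeasure (distr split_law (PiM UNIV (\<lambda>_. unif)) glue)
        (prod_emb UNIV (\<lambda>_. unif) J (Pi\<^sub>E J F)) = emeasure split_law (X \<times> (Y False \<times> Y True))"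
      using measurable_glue by (subst emeasure_distr) (auto simp: clock_law_def)
    also have "\<dots> = emeasure unif X * (emeasure clock_law (Y False) * emeasure clock_law (Y True))"
      using X Y
      by (simp add: clock_law.emeasure_pair_measure_Times prob_space_imp_sigma_finite
          sigma_finite_measure.emeasure_pair_measure_Times prob_space_pair clock_law.prob_space_axioms)
    also have "\<dots> = (\<Prod>e\<in>J. emeasure unif (F e))"
      unfolding emY prod_sub[OF J, of "\<lambda>e. emeasure unif (F e)"] X_def
      using unif.emeasure_space_1 by simp
    finally show "emeasure (distr split_law (PiM UNIV (\<lambda>_. unif)) glue)
      (prod_emb UNIV (\<lambda>_. unif) J (Pi\<^sub>E J F)) = (\<Prod>e\<in>J. emeasure unif (F e))" .
  qed simp
  then show ?thesis by (simp add: clock_law_def)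
qed

text \<open>Turns an equivalence proved for regular clocks into an identity of probabilities, now
  under a law where the root clock and the branches are independent.\<close>

lemma measure_clock_law_split:
  assumes Q: "Measurable.pred clock_law Q" and R: "Measurable.pred split_law R"
    and eq: "\<And>x p q. regular N (glue (x, p, q)) \<Longrightarrow> Q (glue (x, p, q)) \<longleftrightarrow> R (x, p, q)"
  shows "measure clock_law {\<omega>. Q \<omega>} = measure split_law {z. R z}"
proof -
  have sp: "space split_law = UNIV" by (simp add: space_pair_measure)
  have S: "{\<omega>. Q \<omega>} \<in> sets clock_law" using Q by (simp add: pred_def)
  have "measure clock_law {\<omega>. Q \<omega>} = measure (distr split_law clock_law glue) {\<omega>. Q \<omega>}"
    by (simp only: glue_distr)
  also have "\<dots> = measure split_law {z. Q (glue z)}"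
    using S by (subst measure_distr) (auto simp: sp vimage_def)
  also have "\<dots> = measure split_law {z. R z}"
  proof (rule measure_eq_AE)
    have "AE z in split_law. regular N (glue z)"
    proof (rule AE_distrD[OF measurable_glue])
      show "AE \<omega> in distr split_law clock_law glue. regular N \<omega>"
        unfolding glue_distr by (rule AE_regular)
    qed
    then show "AE z in split_law. z \<in> {z. Q (glue z)} \<longleftrightarrow> z \<in> {z. R z}"
      by eventually_elim (use eq in auto)
    have "Measurable.pred split_law (\<lambda>z. Q (glue z))"
      using measurable_glue Q by (rule measurable_compose)
    then show "{z. Q (glue z)} \<in> sets split_law" by (simp add: pred_def sp)
    show "{z. R z} \<in> sets split_law" using R by (simp add: pred_def sp)
  qed
  finally show ?thesis .
qed

section \<open>The law of the root cluster\<close>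

definition closed_prob :: "nat \<Rightarrow> (real \<Rightarrow> bool) \<Rightarrow> real" where
  "closed_prob N P = measure clock_law {\<omega>. [] \<notin> sol_at N P \<omega>}"

text \<open>Induction on the shape: \<open>join l r\<close> requires the root clock in
  \<open>P\<close> and independent branch clusters \<open>l\<close> and \<open>r\<close>. With p the
  probability of \<open>P\<close> and \<beta> that of a closed root edge, this contributes one
  factor p \<beta> per edge.\<close>

lemma root_cluster_law:
  assumes E: "rooted E" and "card E < N" and P: "Measurable.pred borel P"
    and down: "\<And>x y. x < y \<Longrightarrow> P y \<Longrightarrow> P x"
  shows "measure clock_law {\<omega>. root_cluster (sol_at N P \<omega>) = E} =
    closed_prob N P * (measure unif {x. P x} * closed_prob N P) ^ card E"
  using E \<open>card E < N\<close>
proof induction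
  case rooted_empty
  show ?case by (simp add: closed_prob_def root_cluster_empty_iff)
next
  case (rooted_join l r)
  have fin: "finite l" "finite r" using rooted_join.hyps rooted_finite by auto
  then have card: "card (join l r) = Suc (card l + card r)" by (rule card_join)
  let ?S = "\<lambda>E. {\<omega>. root_cluster (sol_at N P \<omega>) = E}"
  have pred: "Measurable.pred clock_law (\<lambda>\<omega>. root_cluster (sol_at N P \<omega>) = E)" if "rooted E" for E
    using that by (rule pred_root_cluster) (intro pred_sol_at P)
  then have S: "?S E \<in> sets clock_law" if "rooted E" for E using that by (simp add: pred_def)
  have p: "{x. P x} \<in> sets unif" using P by (simp add: pred_def)
  let ?R = "\<lambda>z. z \<in> {x. P x} \<times> (?S l \<times> ?S r)"
  have R: "{x. P x} \<times> (?S l \<times> ?S r) \<in> sets split_law"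
    using p S rooted_join.hyps by (intro pair_measureI) auto
  have "measure clock_law (?S (join l r)) = measure split_law {z. ?R z}"
  proof (rule measure_clock_law_split[where N = N])
    show "Measurable.pred clock_law (\<lambda>\<omega>. root_cluster (sol_at N P \<omega>) = join l r)"
      by (intro pred rooted.rooted_join rooted_join.hyps)
    show "Measurable.pred split_law ?R"
    proof -
      have "{z \<in> space split_law. ?R z} = {x. P x} \<times> (?S l \<times> ?S r)"
        by (auto simp: space_pair_measure)
      with R show ?thesis by (simp only: pred_def)
    qed
    fix x p q assume "regular N (glue (x, p, q))"
    from root_cluster_eq_join_iff[OF this down fin] rooted_join.prems
    show "root_cluster (sol_at N P (glue (x, p, q))) = join l r \<longleftrightarrow> ?R (x, p, q)"
      by auto
  qed
  also have "\<dots> = measure split_law ({x. P x} \<times> (?S l \<times> ?S r))" by simp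
  also have "\<dots> = measure unif {x. P x} * (measure clock_law (?S l) * measure clock_law (?S r))"
    using p S rooted_join.hyps
    by (simp add: measure_Times prob_space_pair prob_space_unif clock_law.prob_space_axioms)
  also have "\<dots> = closed_prob N P * (measure unif {x. P x} * closed_prob N P) ^ card (join l r)"
    using rooted_join.IH rooted_join.prems by (simp add: card power_add mult_ac)
  finally show ?case .
qed

section \<open>Laws of the branch clusters at and just before a fixed time\<close>

definition closed_at :: "nat \<Rightarrow> real \<Rightarrow> real" where
  "closed_at N t = closed_prob N (\<lambda>x. x \<le> t)"

text \<open>The two states of the root edge differ only if its clock rings exactly at
  \<open>t\<close>, a null event.\<close>

lemma closed_before: "closed_prob N (\<lambda>x. x < t) = closed_at N t"
  unfolding closed_at_def closed_prob_def
proof (rule measure_eq_AE)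
  have "AE \<omega> in clock_law. \<omega> [] \<noteq> t" by (rule AE_clock[OF AE_unif_neq])
  then show "AE \<omega> in clock_law. \<omega> \<in> {\<omega>. [] \<notin> sol_at N (\<lambda>x. x < t) \<omega>} \<longleftrightarrow>
      \<omega> \<in> {\<omega>. [] \<notin> sol_at N (\<lambda>x. x \<le> t) \<omega>}"
    by eventually_elim (auto simp: sol_at_def)
  have "Measurable.pred clock_law (\<lambda>\<omega>. [] \<notin> sol_at N P \<omega>)" if "Measurable.pred borel P" for P
    by (intro pred_intros_logic pred_sol_at that)
  then have "{\<omega>. [] \<notin> sol_at N P \<omega>} \<in> sets clock_law" if "Measurable.pred borel P" for P
    using that by (simp add: pred_def)
  then show "{\<omega>. [] \<notin> sol_at N (\<lambda>x. x < t) \<omega>} \<in> sets clock_law"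
    "{\<omega>. [] \<notin> sol_at N (\<lambda>x. x \<le> t) \<omega>} \<in> sets clock_law" by simp_all
qed

lemma measure_unif_lessThan: "0 \<le> t \<Longrightarrow> t \<le> 1 \<Longrightarrow> measure unif {x. x < t} = t"
proof -
  assume t: "0 \<le> t" "t \<le> 1"
  then have "{0..1} \<inter> {x. x < t} = {0..<t}" by auto
  with t show ?thesis by (simp add: measure_def emeasure_unif)
qed

lemma root_cluster_law_at:
  assumes "rooted E" "card E < N" "0 \<le> t" "t \<le> 1"
  shows "measure clock_law {\<omega>. root_cluster (sol_at N (\<lambda>x. x \<le> t) \<omega>) = E} =
      closed_at N t * (t * closed_at N t) ^ card E"
    and "measure clock_law {\<omega>. root_cluster (sol_at N (\<lambda>x. x < t) \<omega>) = E} =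
      closed_at N t * (t * closed_at N t) ^ card E"
  using root_cluster_law[OF assms(1,2), of "\<lambda>x. x \<le> t"] root_cluster_law[OF assms(1,2), of "\<lambda>x. x < t"]
    assms(3,4) by (simp_all add: measure_unif_atMost measure_unif_lessThan closed_before flip: closed_at_def)

text \<open>The pairs of clusters of the two branches with less than \<open>N\<close> edges in total are indexed by the
  rooted sets with at most \<open>N\<close> edges that contain the root edge.\<close>

definition small_joins :: "nat \<Rightarrow> edge set set" where
  "small_joins N = (\<Union>n<N. rooted_sets (Suc n))"

lemma join_in_small_joins:
  "join l r \<in> small_joins N \<longleftrightarrow> rooted l \<and> rooted r \<and> card l + card r < N"
proof
  assume "join l r \<in> small_joins N"
  then obtain n where n: "n < N" "rooted (join l r)" "card (join l r) = Suc n"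
    by (auto simp: small_joins_def rooted_sets_def)
  from n(2) have lr: "rooted l" "rooted r"
    by (cases rule: rooted.cases, metis Nil_in_join empty_iff, metis join_inject)+
  with n show "rooted l \<and> rooted r \<and> card l + card r < N"
    by (simp add: card_join rooted_finite)
next
  assume "rooted l \<and> rooted r \<and> card l + card r < N"
  then show "join l r \<in> small_joins N"
    by (auto simp: small_joins_def rooted_sets_def card_join rooted_finite intro: rooted_join)
qed

lemma small_joins_cases:
  assumes "E \<in> small_joins N"
  obtains l r where "E = join l r" "rooted l" "rooted r" "card l + card r < N"
proof -
  from assms obtain n where "rooted E" "card E = Suc n" by (auto simp: small_joins_def rooted_sets_def)
  then obtain l r where "E = join l r" by (cases rule: rooted.cases) auto
  with assms that show thesis by (simp add: join_in_small_joins)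
qed

lemma finite_small_joins: "finite (small_joins N)"
  by (simp add: small_joins_def finite_rooted_sets)

text \<open>Testing membership of the join in a finite family presents the condition as a finite
  disjoint union of product events.\<close>

definition both_small :: "nat \<Rightarrow> real \<Rightarrow> (edge \<Rightarrow> real) \<times> (edge \<Rightarrow> real) \<Rightarrow> bool" where
  "both_small N x y \<longleftrightarrow> join (root_cluster (sol_at N (\<lambda>s. s < x) (fst y)))
     (root_cluster (sol_at N (\<lambda>s. s < x) (snd y))) \<in> small_joins N"

lemma pred_root_cluster_before:
  assumes "rooted E" "f \<in> borel_measurable M" "g \<in> measurable M clock_law"
  shows "Measurable.pred M (\<lambda>z. root_cluster (sol_at N (\<lambda>s. s < f z) (g z)) = E)"
proof (rule pred_root_cluster[OF assms(1)])
  note [measurable] = assms(2,3)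
  have "Measurable.pred M (\<lambda>z. e \<in> sol N (g z))" for e
    using assms(3) pred_sol by (rule measurable_compose)
  moreover have "(\<lambda>z. g z e) \<in> borel_measurable M" for e
    using assms(3) measurable_clock by (rule measurable_compose)
  ultimately show "Measurable.pred M (\<lambda>z. e \<in> sol_at N (\<lambda>s. s < f z) (g z))" for e
    unfolding sol_at_def mem_Collect_eq by (intro pred_intros_logic borel_measurable_pred_less assms)
qed


lemma both_small_iff:
  "both_small N x y \<longleftrightarrow> (\<exists>E\<in>small_joins N.
     root_cluster (sol_at N (\<lambda>s. s < x) (fst y)) = sub False E \<and>
     root_cluster (sol_at N (\<lambda>s. s < x) (snd y)) = sub True E)"
proof
  assume "\<exists>E\<in>small_joins N. root_cluster (sol_at N (\<lambda>s. s < x) (fst y)) = sub False E \<and>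
     root_cluster (sol_at N (\<lambda>s. s < x) (snd y)) = sub True E"
  then show "both_small N x y"
    unfolding both_small_def by (auto elim!: small_joins_cases simp: join_in_small_joins)
next
  assume "both_small N x y"
  then show "\<exists>E\<in>small_joins N. root_cluster (sol_at N (\<lambda>s. s < x) (fst y)) = sub False E \<and>
     root_cluster (sol_at N (\<lambda>s. s < x) (snd y)) = sub True E"
    unfolding both_small_def by (rule rev_bexI) simp
qed

lemma rooted_sub: "E \<in> small_joins N \<Longrightarrow> rooted (sub b E)"
  by (auto elim!: small_joins_cases)

lemma pred_both_small: "Measurable.pred split_law (\<lambda>z. both_small N (fst z) (snd z))"
  unfolding both_small_iff
  by (intro pred_intros_finite finite_small_joins pred_intros_logic pred_root_cluster_before rooted_sub)
    auto

lemma measure_both_small: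
  assumes x: "0 \<le> x" "x \<le> 1"
  shows "measure (clock_law \<Otimes>\<^sub>M clock_law) {y. both_small N x y} =
    (closed_at N x)\<^sup>2 * branch_gf N (x * closed_at N x)"
proof -
  let ?S = "\<lambda>E. {\<omega>. root_cluster (sol_at N (\<lambda>s. s < x) \<omega>) = E}"
  have S: "?S E \<in> sets clock_law" if "rooted E" for E
    using pred_root_cluster_before[OF that, of "\<lambda>_. x" clock_law "\<lambda>\<omega>. \<omega>" N] by (simp add: pred_def)
  let ?T = "\<lambda>E. ?S (sub False E) \<times> ?S (sub True E)"
  interpret pair: prob_space "clock_law \<Otimes>\<^sub>M clock_law"
    by (intro prob_space_pair clock_law.prob_space_axioms)
  have "{y. both_small N x y} = (\<Union>E\<in>small_joins N. ?T E)"
    by (auto simp: both_small_iff)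
  also have "measure (clock_law \<Otimes>\<^sub>M clock_law) \<dots> = (\<Sum>E\<in>small_joins N. measure (clock_law \<Otimes>\<^sub>M clock_law) (?T E))"
  proof (rule pair.finite_measure_finite_Union)
    show "finite (small_joins N)" by (rule finite_small_joins)
    show "?T ` small_joins N \<subseteq> sets (clock_law \<Otimes>\<^sub>M clock_law)"
      using S rooted_sub by (auto intro!: pair_measureI)
    show "disjoint_family_on ?T (small_joins N)"
      by (auto simp: disjoint_family_on_def elim!: small_joins_cases)
  qed
  \<comment> \<open>\<open>card E\<close> counts the root edge of the join, which belongs to neither
    branch cluster.\<close>
  also have "\<dots> = (\<Sum>E\<in>small_joins N. (closed_at N x)\<^sup>2 * (x * closed_at N x) ^ (card E - 1))"
  proof (rule sum.cong[OF refl])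
    fix E assume E: "E \<in> small_joins N"
    then obtain l r where lr: "E = join l r" "rooted l" "rooted r" "card l + card r < N"
      by (rule small_joins_cases)
    then have "measure (clock_law \<Otimes>\<^sub>M clock_law) (?T E) = measure clock_law (?S l) * measure clock_law (?S r)"
      using S by (simp add: measure_Times clock_law.prob_space_axioms)
    then show "measure (clock_law \<Otimes>\<^sub>M clock_law) (?T E) = (closed_at N x)\<^sup>2 * (x * closed_at N x) ^ (card E - 1)"
      using lr x by (simp add: root_cluster_law_at(2) card_join rooted_finite power_add power2_eq_square mult_ac)
  qed
  also have "\<dots> = (\<Sum>n<N. \<Sum>E\<in>rooted_sets (Suc n). (closed_at N x)\<^sup>2 * (x * closed_at N x) ^ (card E - 1))"
    unfolding small_joins_def
    by (rule sum.UNION_disjoint) (auto simp: finite_rooted_sets, auto simp: rooted_sets_def)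
  also have "\<dots> = (\<Sum>n<N. \<Sum>E\<in>rooted_sets (Suc n). (closed_at N x)\<^sup>2 * (x * closed_at N x) ^ n)"
    by (intro sum.cong) (auto simp: rooted_sets_def)
  also have "\<dots> = (closed_at N x)\<^sup>2 * branch_gf N (x * closed_at N x)"
    by (simp add: branch_gf_def rooted_count_def sum_distrib_left mult_ac)
  finally show ?thesis .
qed

lemma both_small_root_clusters:
  "both_small N x (p, q) \<longleftrightarrow>
    finite (root_cluster (sol_at N (\<lambda>s. s < x) p)) \<and> finite (root_cluster (sol_at N (\<lambda>s. s < x) q)) \<and>
    card (root_cluster (sol_at N (\<lambda>s. s < x) p)) + card (root_cluster (sol_at N (\<lambda>s. s < x) q)) < N"
  unfolding both_small_def join_in_small_joins fst_conv snd_conv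
  using rooted_finite rooted_root_cluster by blast

section \<open>The integral equation for the closing probability\<close>

lemma closed_at_bounds: "0 \<le> closed_at N t" "closed_at N t \<le> 1"
  by (simp_all add: closed_at_def closed_prob_def)

lemma closed_at_sets: "{\<omega>. [] \<notin> sol_at N (\<lambda>x. x \<le> t) \<omega>} \<in> sets clock_law"
proof -
  have "Measurable.pred clock_law (\<lambda>\<omega>. [] \<notin> sol_at N (\<lambda>x. x \<le> t) \<omega>)"
    by (intro pred_intros_logic pred_sol_at) simp
  then show ?thesis by (simp add: pred_def)
qed

text \<open>The state of the root edge changes between \<open>s\<close> and \<open>t\<close> only if
  its clock rings in between.\<close>

lemma closed_at_lipschitz:
  assumes "s \<le> t" shows "\<bar>closed_at N t - closed_at N s\<bar> \<le> t - s"
proof -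
  let ?C = "\<lambda>t. {\<omega>. [] \<notin> sol_at N (\<lambda>x. x \<le> t) \<omega>}" and ?D = "{\<omega>. \<omega> [] \<in> {s<..t}}"
  have D: "?D \<in> sets clock_law"
    using measurable_sets[OF measurable_clock, of "{s<..t}"] by (simp add: vimage_def)
  have "emeasure clock_law ?D = emeasure unif {s<..t}"
    using emeasure_clocks[of "{[]}" "\<lambda>_. {s<..t}"] by simp
  also have "\<dots> \<le> emeasure lborel {s<..t}"
    by (simp add: emeasure_unif) (rule emeasure_mono, auto)
  finally have "measure clock_law ?D \<le> t - s"
    using assms by (simp add: clock_law.emeasure_eq_measure)
  moreover have "measure clock_law (?C s) \<le> measure clock_law (?C t \<union> ?D)"
  proof (rule clock_law.finite_measure_mono)
    show "?C s \<subseteq> ?C t \<union> ?D" by (auto simp: sol_at_def)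
    show "?C t \<union> ?D \<in> sets clock_law" by (intro sets.Un closed_at_sets D)
  qed
  moreover have "measure clock_law (?C t \<union> ?D) \<le> measure clock_law (?C t) + measure clock_law ?D"
    by (rule measure_Un_le[OF closed_at_sets D])
  moreover have "measure clock_law (?C t) \<le> measure clock_law (?C s)"
    by (rule clock_law.finite_measure_mono[OF _ closed_at_sets]) (use assms in \<open>auto simp: sol_at_def\<close>)
  ultimately show ?thesis by (simp add: closed_at_def closed_prob_def)
qed

lemma closed_at_continuous: "continuous_on S (closed_at N)"
proof (rule lipschitz_on_continuous_on)
  show "1-lipschitz_on S (closed_at N)"
  proof (rule lipschitz_onI)
    fix x y show "dist (closed_at N x) (closed_at N y) \<le> 1 * dist x y"
      using closed_at_lipschitz[of x y N] closed_at_lipschitz[of y x N]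
      by (cases "x \<le> y") (auto simp: dist_real_def)
  qed simp
qed

abbreviation closing_rate :: "nat \<Rightarrow> real \<Rightarrow> real" where
  "closing_rate N x \<equiv> (closed_at N x)\<^sup>2 * branch_gf N (x * closed_at N x)"

lemma closing_rate_continuous: "continuous_on S (closing_rate N)"
  unfolding branch_gf_def by (intro continuous_intros closed_at_continuous)

lemma closing_rate_nonneg: "0 \<le> x \<Longrightarrow> 0 \<le> closing_rate N x"
  using closed_at_bounds by (simp add: branch_gf_nonneg)

text \<open>By \<open>root_opens_iff\<close> the root edge is open at \<open>t\<close> iff its clock
  \<open>x\<close> is at most \<open>t\<close> and the branch clusters just before \<open>x\<close>
  are jointly small. Integrating over \<open>x\<close>, independent of the branches, gives the
  integral.\<close>

lemma closed_at_integral: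
  assumes "N > 0" and t: "0 \<le> t" "t \<le> 1"
  shows "closed_at N t = 1 - integral {0..t} (closing_rate N)"
proof -
  let ?R = "\<lambda>z. fst z \<le> t \<and> both_small N (fst z) (snd z)"
  have R: "Measurable.pred split_law ?R"
  proof -
    have "Measurable.pred split_law (\<lambda>z. fst z \<le> t)" by measurable
    then show ?thesis by (intro pred_intros_logic pred_both_small)
  qed
  have sp: "space split_law = UNIV" by (simp add: space_pair_measure)
  have setR: "{z. ?R z} \<in> sets split_law" using R by (simp add: pred_def sp)
  interpret pair: prob_space "clock_law \<Otimes>\<^sub>M clock_law"
    by (intro prob_space_pair clock_law.prob_space_axioms)
  interpret split: prob_space split_law
    by (intro prob_space_pair pair.prob_space_axioms unif.prob_space_axioms)
  have open_sets: "{\<omega>. [] \<in> sol_at N (\<lambda>x. x \<le> t) \<omega>} \<in> sets clock_law"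
  proof -
    have "Measurable.pred clock_law (\<lambda>\<omega>. [] \<in> sol_at N (\<lambda>x. x \<le> t) \<omega>)"
      by (intro pred_sol_at) simp
    then show ?thesis by (simp add: pred_def)
  qed
  have compl: "{\<omega>. [] \<notin> sol_at N (\<lambda>x. x \<le> t) \<omega>} =
      space clock_law - {\<omega>. [] \<in> sol_at N (\<lambda>x. x \<le> t) \<omega>}" by auto
  have "closed_at N t = 1 - measure clock_law {\<omega>. [] \<in> sol_at N (\<lambda>x. x \<le> t) \<omega>}"
    unfolding closed_at_def closed_prob_def compl by (rule clock_law.prob_compl[OF open_sets])
  also have "measure clock_law {\<omega>. [] \<in> sol_at N (\<lambda>x. x \<le> t) \<omega>} = measure split_law {z. ?R z}"
  proof (rule measure_clock_law_split[where N = N])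
    show "Measurable.pred clock_law (\<lambda>\<omega>. [] \<in> sol_at N (\<lambda>x. x \<le> t) \<omega>)"
      by (intro pred_sol_at) simp
    fix x p q assume "regular N (glue (x, p, q))"
    from root_opens_iff[OF this \<open>N > 0\<close>]
    show "[] \<in> sol_at N (\<lambda>x. x \<le> t) (glue (x, p, q)) \<longleftrightarrow> ?R (x, p, q)"
      by (auto simp: sol_at_def[of N "\<lambda>x. x \<le> t"] both_small_root_clusters all_bool_eq)
  qed (rule R)
  also have "\<dots> = integral {0..t} (closing_rate N)"
  proof -
    have "emeasure split_law {z. ?R z} =
        (\<integral>\<^sup>+x. emeasure (clock_law \<Otimes>\<^sub>M clock_law) (Pair x -` {z. ?R z}) \<partial>unif)"
      using setR by (rule pair.emeasure_pair_measure_alt)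
    also have "\<dots> = (\<integral>\<^sup>+x. emeasure (clock_law \<Otimes>\<^sub>M clock_law) (Pair x -` {z. ?R z}) * indicator {0..1} x \<partial>lborel)"
      unfolding unif_def
    proof (subst nn_integral_uniform_measure)
      have "(\<lambda>x. emeasure (clock_law \<Otimes>\<^sub>M clock_law) (Pair x -` {z. ?R z})) \<in> borel_measurable unif"
        using setR by (rule pair.measurable_emeasure_Pair)
      then show "(\<lambda>x. emeasure (clock_law \<Otimes>\<^sub>M clock_law) (Pair x -` {z. ?R z})) \<in> borel_measurable lborel"
        by (simp add: measurable_cong_sets[OF sets_unif refl])
    qed (auto simp: divide_ennreal_def)
    also have "\<dots> = (\<integral>\<^sup>+x. ennreal (closing_rate N x) * indicator {0..t} x \<partial>lborel)"
    proof (rule nn_integral_cong)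
      fix x
      show "emeasure (clock_law \<Otimes>\<^sub>M clock_law) (Pair x -` {z. ?R z}) * indicator {0..1} x =
          ennreal (closing_rate N x) * indicator {0..t} x"
      proof (cases "0 \<le> x \<and> x \<le> t")
        case True
        then have "Pair x -` {z. ?R z} = {y. both_small N x y}" by auto
        with True t show ?thesis
          by (simp add: pair.emeasure_eq_measure measure_both_small)
      next
        case False
        \<comment> \<open>Negative clocks are removed by the indicator of the unit interval; clocks
          after \<open>t\<close> have an empty section.\<close>
        then have "x < 0 \<or> Pair x -` {z. ?R z} = {}" by auto
        with False show ?thesis by (auto simp: indicator_def)
      qed
    qed
    also have "\<dots> = ennreal (integral {0..t} (closing_rate N))"
    proof (rule nn_integral_has_integral_lebesgue')
      show "(closing_rate N has_integral integral {0..t} (closing_rate N)) {0..t}"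
        by (intro integrable_integral integrable_continuous_real closing_rate_continuous)
    qed (rule closing_rate_nonneg, simp)
    finally have "emeasure split_law {z. ?R z} = ennreal (integral {0..t} (closing_rate N))" .
    moreover have "0 \<le> integral {0..t} (closing_rate N)"
      by (intro integral_nonneg integrable_continuous_real closing_rate_continuous closing_rate_nonneg) simp
    ultimately show ?thesis by (simp add: measure_def)
  qed
  finally show ?thesis .
qed

text \<open>The Lipschitz bound makes the integrand continuous, so the integral equation can be
  differentiated.\<close>

lemma closed_ode_closed_at:
  assumes "N > 0" shows "closed_ode N (closed_at N)"
proof
  show "closed_at N 0 = 1" using closed_at_integral[OF assms, of 0] by simp
  show "continuous_on {0..1} (closed_at N)" by (rule closed_at_continuous)
  fix s :: real assume s: "0 < s" "s < 1"
  have "((\<lambda>t. integral {0..t} (closing_rate N)) has_real_derivative closing_rate N s) (at s within {0..1})"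
    by (rule integral_has_real_derivative[OF closing_rate_continuous]) (use s in auto)
  moreover have "at s within {0..1} = at s" using s by (intro at_within_interior) simp
  ultimately have "((\<lambda>t. 1 - integral {0..t} (closing_rate N)) has_real_derivative 0 - closing_rate N s) (at s)"
    by (intro DERIV_diff DERIV_const) (simp only:)
  then show "(closed_at N has_real_derivative - closing_rate N s) (at s)"
    unfolding diff_0
    by (rule has_field_derivative_transform_within_open[of _ _ _ "{0<..<1}"])
      (use s closed_at_integral[OF assms] in auto)
qed (auto simp: closed_at_bounds)

section \<open>The frozen percolation process as a function of the clocks\<close>

context edge_clocks
begin

lemma clocks_measurable: "(\<lambda>\<omega> e. \<tau> e \<omega>) \<in> measurable M clock_law"
  using indep_clocks by (intro measurable_into_clock_law) (auto simp: indep_vars_def)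

lemma clocks_distr: "distr M clock_law (\<lambda>\<omega> e. \<tau> e \<omega>) = clock_law"
proof -
  have "distr M (PiM UNIV (\<lambda>_. borel)) (\<lambda>\<omega>. \<lambda>e\<in>UNIV. \<tau> e \<omega>) = PiM UNIV (\<lambda>e. distr M borel (\<tau> e))"
    using indep_clocks by (subst indep_vars_iff_distr_eq_PiM[symmetric]) (auto simp: indep_vars_def)
  then have "distr M (PiM UNIV (\<lambda>_. borel)) (\<lambda>\<omega> e. \<tau> e \<omega>) = clock_law"
    by (simp add: restrict_UNIV uniform_clocks clock_law_def unif_def)
  moreover have "distr M (PiM UNIV (\<lambda>_. borel)) (\<lambda>\<omega> e. \<tau> e \<omega>) = distr M clock_law (\<lambda>\<omega> e. \<tau> e \<omega>)"
    by (rule distr_cong) (auto simp: sets_clock_law)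
  ultimately show ?thesis by simp
qed

lemma AE_clocks:
  assumes "AE \<omega> in clock_law. Q \<omega>" shows "AE \<omega> in M. Q (\<lambda>e. \<tau> e \<omega>)"
proof (rule AE_distrD[OF clocks_measurable])
  show "AE \<omega> in distr M clock_law (\<lambda>\<omega> e. \<tau> e \<omega>). Q \<omega>"
    unfolding clocks_distr by (rule assms)
qed

end

context frozen_percolation
begin

text \<open>No functional dependence on the clocks is assumed of the process; it follows from
  uniqueness of solutions, almost surely.\<close>

lemma AE_open:
  assumes t: "t \<in> {0..1}"
  shows "AE \<omega> in M. A \<omega> t = sol_at N (\<lambda>x. x \<le> t) (\<lambda>e. \<tau> e \<omega>)"
  using AE_clocks[OF AE_wf_dependence[of N]] AE_clocks[OF AE_clock_range] dynamics
proof eventually_elim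
  case (elim \<omega>)
  define \<sigma> where "\<sigma> e = \<tau> e \<omega>" for e
  \<comment> \<open>The edges that pass the test at their own clock, which are the edges that ever
    open.\<close>
  define X where "X = {e. \<forall>v\<in>ends e. small N (open_before (A \<omega>) (\<sigma> e)) v}"
  have A: "A \<omega> s = {e \<in> X. \<sigma> e \<le> s}" if "s \<in> {0..1}" for s
    using bspec[OF elim(3) that] unfolding volume_less_iff_small X_def \<sigma>_def by auto
  have range: "0 \<le> \<sigma> e" "\<sigma> e \<le> 1" for e using elim(2) by (auto simp: \<sigma>_def)
  have before: "open_before (A \<omega>) (\<sigma> e) = {g \<in> X. \<sigma> g < \<sigma> e}" for e
  proof
    show "open_before (A \<omega>) (\<sigma> e) \<subseteq> {g \<in> X. \<sigma> g < \<sigma> e}"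
      using range[of e] by (auto simp: open_before_def A)
    show "{g \<in> X. \<sigma> g < \<sigma> e} \<subseteq> open_before (A \<omega>) (\<sigma> e)"
    proof
      fix g assume g: "g \<in> {g \<in> X. \<sigma> g < \<sigma> e}"
      \<comment> \<open>\<open>g\<close> is already open at its own clock value, which serves as the
        witness time before the clock of \<open>e\<close>.\<close>
      then have "g \<in> A \<omega> (\<sigma> g)" "\<sigma> g \<in> {0..<\<sigma> e}" using A range by auto
      then show "g \<in> open_before (A \<omega>) (\<sigma> e)" unfolding open_before_def by blast
    qed
  qed
  have wf: "wf (dependence N \<sigma>)" using elim(1) by (simp add: \<sigma>_def[abs_def])
  have "solves N \<sigma> (\<lambda>_. True) X"
    by (simp add: solves_def opens_def before[symmetric]) (simp add: X_def)
  then have "e \<in> X \<longleftrightarrow> e \<in> sol N \<sigma>" for e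
    using solves_unique[OF wf _ _ solves_sol[OF wf]] by blast
  then have "A \<omega> t = sol_at N (\<lambda>x. x \<le> t) \<sigma>"
    using A[OF t] by (auto simp: sol_at_def)
  then show ?case by (simp add: \<sigma>_def[abs_def])
qed

lemma prob_root_cluster:
  assumes E: "rooted E" "card E < N" and t: "t \<in> {0..1}"
  shows "prob {\<omega> \<in> space M. root_cluster (A \<omega> t) = E} = closed_at N t * (t * closed_at N t) ^ card E"
proof -
  let ?S = "{\<omega>. root_cluster (sol_at N (\<lambda>x. x \<le> t) \<omega>) = E}"
  have "Measurable.pred clock_law (\<lambda>\<omega>. root_cluster (sol_at N (\<lambda>x. x \<le> t) \<omega>) = E)"
    using E(1) by (rule pred_root_cluster) (intro pred_sol_at, simp)
  then have S: "?S \<in> sets clock_law" by (simp add: pred_def)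
  have "Measurable.pred M (\<lambda>\<omega>. root_cluster (A \<omega> t) = E)"
    using E(1) by (rule pred_root_cluster) (use measurable_open[OF t] in \<open>simp add: pred_def\<close>)
  then have "prob {\<omega> \<in> space M. root_cluster (A \<omega> t) = E} =
      prob ((\<lambda>\<omega> e. \<tau> e \<omega>) -` ?S \<inter> space M)"
    using measurable_sets[OF clocks_measurable S] AE_open[OF t]
    by (intro measure_eq_AE) (auto simp: pred_def)
  also have "\<dots> = measure (distr M clock_law (\<lambda>\<omega> e. \<tau> e \<omega>)) ?S"
    using S by (intro measure_distr[symmetric] clocks_measurable)
  also have "\<dots> = closed_at N t * (t * closed_at N t) ^ card E"
    unfolding clocks_distr using E t by (intro root_cluster_law_at) auto
  finally show ?thesis .
qed

end

section \<open>Convergence\<close>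

text \<open>Stated for an arbitrary random edge set, so that it serves both the
  \<open>N\<close>-parameter process and Aldous' process: in each, all root clusters of one volume
  have equal weight.\<close>

lemma (in prob_space) prob_volume:
  fixes w :: real
  assumes X: "\<And>g. {\<omega> \<in> space M. g \<in> X \<omega>} \<in> events"
    and w: "\<And>E. E \<in> rooted_sets n \<Longrightarrow> prob {\<omega> \<in> space M. root_cluster (X \<omega>) = E} = w"
  shows "{\<omega> \<in> space M. cluster_volume (open_cluster (X \<omega>) Root) = enat n} \<in> events"
    and "prob {\<omega> \<in> space M. cluster_volume (open_cluster (X \<omega>) Root) = enat n} = rooted_count n * w"
proof -
  let ?S = "\<lambda>E. {\<omega> \<in> space M. root_cluster (X \<omega>) = E}"
  have eq: "{\<omega> \<in> space M. cluster_volume (open_cluster (X \<omega>) Root) = enat n} = (\<Union>E\<in>rooted_sets n. ?S E)"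
    by (auto simp: volume_eq_iff)
  have "Measurable.pred M (\<lambda>\<omega>. root_cluster (X \<omega>) = E)" if "rooted E" for E
    using that by (rule pred_root_cluster) (use X in \<open>simp add: pred_def\<close>)
  then have S: "?S ` rooted_sets n \<subseteq> events" by (auto simp: pred_def rooted_sets_def)
  show "{\<omega> \<in> space M. cluster_volume (open_cluster (X \<omega>) Root) = enat n} \<in> events"
    unfolding eq using S finite_rooted_sets by (intro sets.finite_UN) auto
  have "prob (\<Union>E\<in>rooted_sets n. ?S E) = (\<Sum>E\<in>rooted_sets n. prob (?S E))"
    using finite_rooted_sets S by (rule finite_measure_finite_Union) (auto simp: disjoint_family_on_def)
  also have "\<dots> = rooted_count n * w" using w by (simp add: rooted_count_def)
  finally show "prob {\<omega> \<in> space M. cluster_volume (open_cluster (X \<omega>) Root) = enat n} = rooted_count n * w"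
    unfolding eq .
qed

context frozen_percolation
begin

lemma prob_volume_frozen:
  assumes "n < N" "t \<in> {0..1}"
  shows "{\<omega> \<in> space M. cluster_volume (open_cluster (A \<omega> t) Root) = enat n} \<in> events"
    and "prob {\<omega> \<in> space M. cluster_volume (open_cluster (A \<omega> t) Root) = enat n} =
      rooted_count n * closed_at N t * (t * closed_at N t) ^ n"
proof -
  have w: "prob {\<omega> \<in> space M. root_cluster (A \<omega> t) = E} = closed_at N t * (t * closed_at N t) ^ n"
    if "E \<in> rooted_sets n" for E
    using prob_root_cluster[of E t] that assms by (simp add: rooted_sets_def)
  show "{\<omega> \<in> space M. cluster_volume (open_cluster (A \<omega> t) Root) = enat n} \<in> events"
    using measurable_open[OF assms(2)] w by (rule prob_volume(1))
  show "prob {\<omega> \<in> space M. cluster_volume (open_cluster (A \<omega> t) Root) = enat n} =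
      rooted_count n * closed_at N t * (t * closed_at N t) ^ n"
    using prob_volume(2)[OF measurable_open[OF assms(2)] w] by simp
qed

lemma prob_volume_between:
  fixes k :: nat
  assumes t: "t \<in> {0..1}"
  defines "B \<equiv> {\<omega> \<in> space M. enat k \<le> cluster_volume (open_cluster (A \<omega> t) Root) \<and>
      cluster_volume (open_cluster (A \<omega> t) Root) < enat N}"
  shows "B \<in> events" and "prob B = (\<Sum>n=k..<N. rooted_count n * closed_at N t * (t * closed_at N t) ^ n)"
proof -
  let ?V = "\<lambda>n. {\<omega> \<in> space M. cluster_volume (open_cluster (A \<omega> t) Root) = enat n}"
  have "enat k \<le> v \<and> v < enat N \<longleftrightarrow> (\<exists>n\<in>{k..<N}. v = enat n)" for v
    by (cases v) auto
  then have eq: "B = (\<Union>n\<in>{k..<N}. ?V n)" unfolding B_def by auto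
  have V: "?V ` {k..<N} \<subseteq> events" using prob_volume_frozen(1)[OF _ t] by auto
  show "B \<in> events" unfolding eq using V by (intro sets.finite_UN) auto
  have "prob B = (\<Sum>n=k..<N. prob (?V n))"
    unfolding eq using V by (intro finite_measure_finite_Union) (auto simp: disjoint_family_on_def)
  then show "prob B = (\<Sum>n=k..<N. rooted_count n * closed_at N t * (t * closed_at N t) ^ n)"
    using prob_volume_frozen(2)[OF _ t] by simp
qed

lemma prob_frozen:
  assumes t: "t \<in> {0..1}"
  shows "prob {\<omega> \<in> space M. enat N \<le> cluster_volume (open_cluster (A \<omega> t) Root)} =
    1 - (\<Sum>n<N. rooted_count n * closed_at N t * (t * closed_at N t) ^ n)"
proof -
  let ?B = "{\<omega> \<in> space M. enat 0 \<le> cluster_volume (open_cluster (A \<omega> t) Root) \<and>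
      cluster_volume (open_cluster (A \<omega> t) Root) < enat N}"
  have "{\<omega> \<in> space M. enat N \<le> cluster_volume (open_cluster (A \<omega> t) Root)} = space M - ?B"
    by (auto simp: zero_enat_def[symmetric])
  then show ?thesis
    using prob_compl[OF prob_volume_between(1)[OF t, of 0]] prob_volume_between(2)[OF t, of 0]
    by (simp add: atLeast0LessThan)
qed

end

lemma rooted_root_cluster_eq: "rooted E \<Longrightarrow> root_cluster E = E"
  by (induction rule: rooted.induct) (simp_all add: root_cluster_closed root_cluster_join)

text \<open>Every rooted edge set comes from a finite cluster at \<open>Root\<close>, so the given
  law of Aldous' process can be applied to each of them.\<close>

lemma rooted_open_cluster:
  assumes "rooted E"
  shows "snd (open_cluster E Root) = E" "finite_cluster (open_cluster E Root)"
    "Root \<in> fst (open_cluster E Root)"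
proof -
  note eq = rooted_root_cluster_eq[OF assms] and fin = rooted_finite[OF assms]
  show "snd (open_cluster E Root) = E" "Root \<in> fst (open_cluster E Root)"
    by (simp_all add: open_cluster_eq eq)
  have "reach E Root \<subseteq> insert Root (\<Union>e\<in>E. ends e)"
    by (rule reach_least) auto
  then have "finite (reach E Root)"
    by (rule finite_subset) (use fin ends_card(1) in auto)
  moreover have "(x, y) \<in> (adjacent E)\<^sup>*" if "x \<in> reach E Root" "y \<in> reach E Root" for x y
    using that reach_eq[OF that(1)] by (auto simp: reach_def)
  moreover have "ends e \<subseteq> reach E Root" if "e \<in> E" for e
    using that eq by (auto simp: cluster_edges_def)
  ultimately show "finite_cluster (open_cluster E Root)"
    using reach_refl[of Root E] fin
    unfolding finite_cluster_def cluster_def open_cluster_eq fst_conv snd_conv eq by blast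
qed

lemma (in aldous_percolation) prob_infinite:
  assumes t: "t \<in> {0..1}"
  shows "prob {\<omega> \<in> space M. cluster_volume (open_cluster (A \<omega> t) Root) = \<infinity>} =
    1 - (\<Sum>n. rooted_count n * aldous_beta t * (t * aldous_beta t) ^ n)"
proof -
  let ?V = "\<lambda>n. {\<omega> \<in> space M. cluster_volume (open_cluster (A \<omega> t) Root) = enat n}"
  have w: "prob {\<omega> \<in> space M. root_cluster (A \<omega> t) = E} = aldous_beta t * (t * aldous_beta t) ^ n"
    if E: "E \<in> rooted_sets n" for E n
  proof -
    let ?C = "open_cluster E Root"
    have "rooted E" "card E = n" using E by (auto simp: rooted_sets_def)
    note C = rooted_open_cluster[OF \<open>rooted E\<close>]
    from root_cluster_law[OF t C(2,3)] show ?thesis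
      by (simp add: finite_cluster_root(1)[OF C(2,3)] C(1) \<open>card E = n\<close>)
  qed
  have V: "?V n \<in> events" and pV: "prob (?V n) = rooted_count n * aldous_beta t * (t * aldous_beta t) ^ n" for n
    using prob_volume[OF measurable_open[OF t] w[of _ n]] by simp_all
  have "(\<lambda>n. prob (?V n)) sums prob (\<Union>n. ?V n)"
    using V by (intro finite_measure_UNION) (auto simp: disjoint_family_on_def)
  then have "prob (\<Union>n. ?V n) = (\<Sum>n. rooted_count n * aldous_beta t * (t * aldous_beta t) ^ n)"
    by (simp add: pV sums_iff)
  moreover have "{\<omega> \<in> space M. cluster_volume (open_cluster (A \<omega> t) Root) = \<infinity>} = space M - (\<Union>n. ?V n)"
  proof -
    have "v = \<infinity> \<longleftrightarrow> \<not> (\<exists>n. v = enat n)" for v :: enat by (cases v) auto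
    then show ?thesis by auto
  qed
  moreover have "(\<Union>n. ?V n) \<in> events" using V by (intro sets.countable_UN) auto
  ultimately show ?thesis by (simp add: prob_compl)
qed

theorem theorem1:
  fixes M :: "nat \<Rightarrow> 'a measure"
    and \<tau> :: "nat \<Rightarrow> edge \<Rightarrow> 'a \<Rightarrow> real"
    and A :: "nat \<Rightarrow> 'a \<Rightarrow> real \<Rightarrow> edge set"
    and M_inf :: "'b measure"
    and \<tau>_inf :: "edge \<Rightarrow> 'b \<Rightarrow> real"
    and A_inf :: "'b \<Rightarrow> real \<Rightarrow> edge set"
    and t :: real
  assumes "\<And>N. N > 0 \<Longrightarrow> frozen_percolation N (M N) (\<tau> N) (A N)"
    and "aldous_percolation M_inf \<tau>_inf A_inf"
    and "t \<in> {0..1}"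
  shows "(\<forall>C. finite_cluster C \<longrightarrow>
           (\<lambda>N. measure (M N) {\<omega> \<in> space (M N). open_cluster (A N \<omega> t) Root = C})
             \<longlonglongrightarrow> measure M_inf {\<omega> \<in> space M_inf. open_cluster (A_inf \<omega> t) Root = C})
       \<and> (\<lambda>k. limsup (\<lambda>N. ereal (measure (M N) {\<omega> \<in> space (M N).
             enat k \<le> cluster_volume (open_cluster (A N \<omega> t) Root) \<and>
             cluster_volume (open_cluster (A N \<omega> t) Root) < enat N}))) \<longlonglongrightarrow> 0
       \<and> (\<lambda>N. measure (M N) {\<omega> \<in> space (M N).
             enat N \<le> cluster_volume (open_cluster (A N \<omega> t) Root)})
           \<longlonglongrightarrow> measure M_inf {\<omega> \<in> space M_inf.
             cluster_volume (open_cluster (A_inf \<omega> t) Root) = \<infinity>}"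
proof -
  interpret inf: aldous_percolation M_inf \<tau>_inf A_inf by fact
  note frozen = assms(1) and t = assms(3)
  have t': "0 \<le> t" "t \<le> 1" using t by auto
  have root_law: "(\<lambda>N. measure (M N) {\<omega> \<in> space (M N). open_cluster (A N \<omega> t) Root = C})
      \<longlonglongrightarrow> measure M_inf {\<omega> \<in> space M_inf. open_cluster (A_inf \<omega> t) Root = C}"
    if C: "finite_cluster C" for C
  proof (cases "Root \<in> fst C")
    case False
    \<comment> \<open>The cluster of \<open>Root\<close> always contains \<open>Root\<close>, so all
      probabilities involved are 0.\<close>
    then have "open_cluster X Root \<noteq> C" for X by (auto simp: open_cluster_eq)
    then show ?thesis by simp
  next
    case True
    \<comment> \<open>As soon as \<open>N\<close> exceeds the volume of \<open>C\<close> the law is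
      given by the explicit formula, whose limit is known.\<close>
    have "\<forall>\<^sub>F N in sequentially. closed_at N t * (t * closed_at N t) ^ card (snd C) =
        measure (M N) {\<omega> \<in> space (M N). open_cluster (A N \<omega> t) Root = C}"
      using eventually_gt_at_top[of "card (snd C)"]
    proof eventually_elim
      case (elim N)
      then interpret frozen_percolation N "M N" "\<tau> N" "A N" by (intro frozen) simp
      show ?case
        using prob_root_cluster[OF finite_cluster_root(2)[OF C True] elim t]
        by (simp add: finite_cluster_root(1)[OF C True])
    qed
    with weight_tendsto[OF closed_ode_closed_at t'] show ?thesis
      unfolding inf.root_cluster_law[OF t C True] by (rule Lim_transform_eventually)
  qed
  let ?p = "\<lambda>k N. measure (M N) {\<omega> \<in> space (M N).
     enat k \<le> cluster_volume (open_cluster (A N \<omega> t) Root) \<and>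
     cluster_volume (open_cluster (A N \<omega> t) Root) < enat N}"
  have tails: "(\<lambda>k. limsup (\<lambda>N. ereal (?p k N))) \<longlonglongrightarrow> 0"
  proof (rule tendsto_sandwich)
    show "\<forall>\<^sub>F k in sequentially. 0 \<le> limsup (\<lambda>N. ereal (?p k N))"
      by (intro always_eventually allI le_Limsup) auto
    show "\<forall>\<^sub>F k in sequentially. limsup (\<lambda>N. ereal (?p k N)) \<le> ereal (cluster_tail k)"
    \<comment> \<open>The tail bound is uniform in \<open>N > 0\<close>, so it survives the limsup
      for each fixed \<open>k\<close>.\<close>
    proof (rule always_eventually, rule allI, rule Limsup_bounded)
      fix k
      show "\<forall>\<^sub>F N in sequentially. ereal (?p k N) \<le> ereal (cluster_tail k)"
        using eventually_gt_at_top[of 0]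
      proof eventually_elim
        case (elim N)
        then interpret frozen_percolation N "M N" "\<tau> N" "A N" by (rule frozen)
        show ?case
          using closed_ode.tail_bound[OF closed_ode_closed_at[OF elim] t', of k]
          by (simp add: prob_volume_between(2)[OF t])
      qed
    qed
    show "(\<lambda>k. ereal (cluster_tail k)) \<longlonglongrightarrow> 0"
      using cluster_tail_tendsto by (simp add: zero_ereal_def)
  qed simp
  have "\<forall>\<^sub>F N in sequentially. 1 - (\<Sum>n<N. rooted_count n * closed_at N t * (t * closed_at N t) ^ n) =
      measure (M N) {\<omega> \<in> space (M N). enat N \<le> cluster_volume (open_cluster (A N \<omega> t) Root)}"
    using eventually_gt_at_top[of 0]
  proof eventually_elim
    case (elim N)
    then interpret frozen_percolation N "M N" "\<tau> N" "A N" by (rule frozen)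
    show ?case by (rule prob_frozen[OF t, symmetric])
  qed
  with tendsto_diff[OF tendsto_const total_weight_tendsto[OF closed_ode_closed_at t']]
  have "(\<lambda>N. measure (M N) {\<omega> \<in> space (M N).
             enat N \<le> cluster_volume (open_cluster (A N \<omega> t) Root)})
           \<longlonglongrightarrow> measure M_inf {\<omega> \<in> space M_inf.
             cluster_volume (open_cluster (A_inf \<omega> t) Root) = \<infinity>}"
    unfolding inf.prob_infinite[OF t] by (rule Lim_transform_eventually)
  with root_law tails show ?thesis by blast
qed

end
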